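(* Let $\beta>1$ be a Pisot number. Then there is a sequence of Borel probability measures $\tau_1,\tau_2,\dots$ on $\mathbb{R}$ with $\dim\tau_n\to1$ as $n\to\infty$, such that every $T_\beta$-invariant Borel probability measure $\nu$ on $[0,1]$ with $0<\dim\nu<1$ resonates with $\tau_n$ for all sufficiently large $n$.
   Context: A Pisot number is an algebraic integer $\beta>1$ whose conjugates have modulus $<1$ (integers $\ge2$ included). $T_\beta(x)=\beta x\bmod1$. For a Borel measure $\theta$, $\dim\theta=\inf\{\dim_H A: \theta(A)>0,\ A \text{ Borel}\}$ (lower Hausdorff dimension). Measures $\mu,\nu$ on $\mathbb{R}$ resonate if $\dim(\mu*\nu)<\min\{1,\dim\mu+\dim\nu\}$, and dissonate otherwise. *)

theory Defs
  imports "HOL-Probability.Probability" "HOL-Computational_Algebra.Polynomial"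
begin

definition pisot :: "real \<Rightarrow> bool" where
  "pisot \<beta> \<longleftrightarrow> \<beta> > 1 \<and>
     (\<exists>p :: int poly. lead_coeff p = 1 \<and> irreducible p \<and>
        poly (map_poly of_int p) \<beta> = 0 \<and>
        (\<forall>z :: complex. poly (map_poly of_int p) z = 0 \<and> z \<noteq> complex_of_real \<beta> \<longrightarrow> cmod z < 1))"

definition beta_map :: "real \<Rightarrow> real \<Rightarrow> real" where
  "beta_map \<beta> x = frac (\<beta> * x)"

definition hausdorff_pre :: "real \<Rightarrow> real \<Rightarrow> real set \<Rightarrow> ennreal" where
  "hausdorff_pre s \<delta> A = Inf {(\<Sum>i. ennreal (diameter (U i) powr s)) | U :: nat \<Rightarrow> real set.
      A \<subseteq> (\<Union>i. U i) \<and> (\<forall>i. bounded (U i) \<and> diameter (U i) \<le> \<delta>)}"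

definition hausdorff_measure :: "real \<Rightarrow> real set \<Rightarrow> ennreal" where
  "hausdorff_measure s A = (SUP \<delta>\<in>{0<..}. hausdorff_pre s \<delta> A)"

definition hausdorff_dim :: "real set \<Rightarrow> real" where
  "hausdorff_dim A = Inf {s. s > 0 \<and> hausdorff_measure s A = 0}"

definition measure_dim :: "real measure \<Rightarrow> real" where
  "measure_dim \<theta> = Inf {hausdorff_dim A | A. A \<in> sets borel \<and> emeasure \<theta> A > 0}"

definition resonate :: "real measure \<Rightarrow> real measure \<Rightarrow> bool" where
  "resonate \<mu> \<nu> \<longleftrightarrow> measure_dim (\<mu> \<star> \<nu>) < min 1 (measure_dim \<mu> + measure_dim \<nu>)"

end

theory Submission
  imports Defs "HOL-Computational_Algebra.Polynomial_Factorial"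
    "HOL-Computational_Algebra.Fundamental_Theorem_Algebra"
begin

text \<open>
  The measure \<open>\<tau>\<^sub>n\<close> is a Cantor-type measure: digits in the base \<open>B = \<beta>^M\<close>, with \<open>M\<close> large, are chosen
  independently and uniformly from about \<open>B/4\<close> well-separated truncated \<open>\<beta>\<close>-expansions, except that
  they are frozen to 0 at the positions in \<open>[N, N + N/n)\<close> for \<open>N = 2\<^sup>k n\<close>. The windows have density
  \<open>O(1/n)\<close>, so a Frostman estimate gives \<open>dim \<tau>\<^sub>n \<longrightarrow> 1\<close>.

  If an invariant \<open>\<nu>\<close> has \<open>dim \<nu> < 1\<close>, it charges a Lebesgue-null set. By Garsia's lemma the
  truncations of length \<open>M\<close> are \<open>c/\<beta>^M\<close>-separated, so those of points of that set are few compared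
  with \<open>\<beta>^M\<close>, and some code for them has expected length below \<open>M ln \<beta>\<close>. Invariance and Markov's
  inequality turn this into sets of \<open>\<nu>\<close>-mass bounded below which are covered by \<open>\<beta>^(sR)\<close>
  intervals of length \<open>\<beta>^(-R)\<close>, with some fixed \<open>s < 1\<close>, for unboundedly many \<open>R\<close>. Look at \<open>\<nu> * \<tau>\<^sub>n\<close>
  at the end of the window starting at \<open>N\<close>: up to position \<open>N\<close> both summands are truncated
  \<open>\<beta>\<close>-expansions, so by Garsia's lemma again the sums take at most \<open>C B^N\<close> values, and inside the window
  only \<open>\<nu>\<close> contributes. These coverings show \<open>dim (\<nu> * \<tau>\<^sub>n) < 1\<close>, while
  \<open>dim \<nu> + dim \<tau>\<^sub>n > 1\<close> for large \<open>n\<close>.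
\<close>

section \<open>Hausdorff dimension\<close>

text \<open>Without a bound on the mesh, upper estimates come from a single cover. For s > 0 zero
  content already forces zero Hausdorff measure, which is all that upper bounds on dimension
  require.\<close>

definition hausdorff_content :: "real \<Rightarrow> real set \<Rightarrow> ennreal" where
  "hausdorff_content s A = Inf {(\<Sum>i. ennreal (diameter (U i) powr s)) | U :: nat \<Rightarrow> real set.
      A \<subseteq> (\<Union>i. U i) \<and> (\<forall>i. bounded (U i))}"

lemma hausdorff_content_mono: "A \<subseteq> B \<Longrightarrow> hausdorff_content s A \<le> hausdorff_content s B"
  unfolding hausdorff_content_def by (rule Inf_superset_mono) blast

lemma hausdorff_content_less_cover:
  assumes "hausdorff_content s A < e"
  obtains U :: "nat \<Rightarrow> real set" where "A \<subseteq> (\<Union>i. U i)" "\<And>i. bounded (U i)"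
    "(\<Sum>i. ennreal (diameter (U i) powr s)) < e"
  using assms unfolding hausdorff_content_def Inf_less_iff by blast

lemma hausdorff_content_le_cover:
  assumes "A \<subseteq> (\<Union>i. U i)" "\<And>i. bounded (U i)"
  shows "hausdorff_content s A \<le> (\<Sum>i. ennreal (diameter (U i) powr s))"
  unfolding hausdorff_content_def by (rule Inf_lower) (use assms in auto)

lemma hausdorff_content_le_diameter:
  assumes "bounded A"
  shows "hausdorff_content s A \<le> ennreal (diameter A powr s)"
proof -
  \<comment> \<open>Padding with empty sets costs nothing: their diameter is 0 and
    \<open>0 powr s = 0\<close>.\<close>
  define U where "U = (\<lambda>i::nat. if i = 0 then A else {})"
  have "hausdorff_content s A \<le> (\<Sum>i. ennreal (diameter (U i) powr s))"
    by (rule hausdorff_content_le_cover) (use assms in \<open>auto simp: U_def\<close>)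
  also have "\<dots> = (\<Sum>i\<in>{0}. ennreal (diameter (U i) powr s))"
    by (rule suminf_finite) (auto simp: U_def diameter_def)
  finally show ?thesis by (simp add: U_def)
qed

lemma hausdorff_content_empty [simp]: "hausdorff_content s {} = 0"
  using hausdorff_content_le_diameter[of "{}" s] by (simp add: diameter_def)

text \<open>Near-optimal covers of the \<open>A n\<close>, with errors e/2^(n+1) that sum to e, are
  merged into one sequence through the pairing of naturals.\<close>

lemma hausdorff_content_UN_le:
  "hausdorff_content s (\<Union>n. A n) \<le> (\<Sum>n. hausdorff_content s (A n))"
proof (rule ennreal_le_epsilon)
  fix e :: real assume e: "e > 0" and fin: "(\<Sum>n. hausdorff_content s (A n)) < top"
  define d where "d = (\<lambda>n. e * (1/2) ^ Suc n)"
  have d: "d n > 0" for n using e by (simp add: d_def)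
  have finn: "hausdorff_content s (A n) < top" for n
    using ennreal_suminf_lessD[OF fin] .
  have "\<exists>U :: nat \<Rightarrow> real set. A n \<subseteq> (\<Union>i. U i) \<and> (\<forall>i. bounded (U i)) \<and>
    (\<Sum>i. ennreal (diameter (U i) powr s)) < hausdorff_content s (A n) + ennreal (d n)" for n
  proof -
    have "hausdorff_content s (A n) < hausdorff_content s (A n) + ennreal (d n)"
      using finn[of n] d[of n] ennreal_add_left_cancel_less[of "hausdorff_content s (A n)" 0 "ennreal (d n)"] by simp
    then show ?thesis using hausdorff_content_less_cover by metis
  qed
  then obtain U :: "nat \<Rightarrow> nat \<Rightarrow> real set" where U: "\<And>n. A n \<subseteq> (\<Union>i. U n i)" "\<And>n i. bounded (U n i)"
    "\<And>n. (\<Sum>i. ennreal (diameter (U n i) powr s)) < hausdorff_content s (A n) + ennreal (d n)"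
    by metis
  define f where "f = (\<lambda>(n, i). ennreal (diameter (U n i) powr s))"
  have "hausdorff_content s (\<Union>n. A n) \<le> (\<Sum>k. ennreal (diameter (case prod_decode k of (n, i) \<Rightarrow> U n i) powr s))"
  proof (rule hausdorff_content_le_cover)
    show "(\<Union>n. A n) \<subseteq> (\<Union>k. case prod_decode k of (n, i) \<Rightarrow> U n i)"
    proof
      fix x assume "x \<in> (\<Union>n. A n)"
      then obtain n i where "x \<in> U n i" using U(1) by blast
      then show "x \<in> (\<Union>k. case prod_decode k of (n, i) \<Rightarrow> U n i)"
        by (intro UN_I[of "prod_encode (n, i)"]) auto
    qed
  qed (use U(2) in \<open>auto split: prod.split\<close>)
  also have "\<dots> = (\<Sum>k. f (prod_decode k))" by (simp add: f_def split_def)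
  also have "\<dots> = (\<Sum>n. \<Sum>i. f (n, i))" by (rule suminf_ennreal_2dimen) simp
  also have "\<dots> \<le> (\<Sum>n. hausdorff_content s (A n) + ennreal (d n))"
    by (rule suminf_le) (use U(3) in \<open>auto simp: f_def intro: less_imp_le\<close>)
  also have "\<dots> = (\<Sum>n. hausdorff_content s (A n)) + (\<Sum>n. ennreal (d n))"
    by (rule suminf_add[symmetric]) auto
  also have "(\<Sum>n. ennreal (d n)) = ennreal e"
  proof -
    have "d sums e" unfolding d_def using sums_mult[OF power_half_series, of e] by simp
    then show ?thesis using d by (intro suminf_ennreal_eq) (auto intro: less_imp_le)
  qed
  finally show "hausdorff_content s (\<Union>n. A n) \<le> (\<Sum>n. hausdorff_content s (A n)) + ennreal e" .
qed

lemma hausdorff_content_finite_UN_le: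
  assumes "finite I" "\<And>i. i \<in> I \<Longrightarrow> hausdorff_content s (A i) \<le> e"
  shows "hausdorff_content s (\<Union>i\<in>I. A i) \<le> of_nat (card I) * e"
  using assms
proof (induction I rule: finite_induct)
  case empty
  then show ?case by simp
next
  case (insert x F)
  define B where "B = (\<lambda>n::nat. if n = 0 then A x else if n = 1 then (\<Union>i\<in>F. A i) else {})"
  have "(\<Union>i\<in>insert x F. A i) = (\<Union>n. B n)"
  proof -
    have "A x \<subseteq> (\<Union>n. B n)" using UN_upper[of 0 UNIV B] by (simp add: B_def)
    moreover have "(\<Union>i\<in>F. A i) \<subseteq> (\<Union>n. B n)" using UN_upper[of 1 UNIV B] by (simp add: B_def)
    moreover have "B n \<subseteq> (\<Union>i\<in>insert x F. A i)" for n by (auto simp: B_def)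
    ultimately show ?thesis by blast
  qed
  then have "hausdorff_content s (\<Union>i\<in>insert x F. A i) \<le> (\<Sum>n. hausdorff_content s (B n))"
    using hausdorff_content_UN_le by simp
  also have "\<dots> = (\<Sum>n\<in>{0,1}. hausdorff_content s (B n))"
    by (rule suminf_finite) (auto simp: B_def)
  also have "\<dots> = hausdorff_content s (A x) + hausdorff_content s (\<Union>i\<in>F. A i)" by (simp add: B_def)
  also have "\<dots> \<le> e + of_nat (card F) * e" using insert by (intro add_mono) auto
  also have "\<dots> = of_nat (card (insert x F)) * e" using insert by (simp add: algebra_simps)
  finally show ?case .
qed

text \<open>In a cover of total cost below \<delta>^s every single diameter is below \<delta>, so
  cheap covers meet any mesh restriction automatically.\<close>

lemma hausdorff_measure_eq_0I:
  assumes s: "s > 0" and 0: "hausdorff_content s A = 0"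
  shows "hausdorff_measure s A = 0"
proof -
  have "hausdorff_pre s \<delta> A \<le> 0 + ennreal e" if "\<delta> > 0" "e > 0" for \<delta> e
  proof -
    have "hausdorff_content s A < ennreal (min e (\<delta> powr s))" using 0 that by simp
    then obtain U :: "nat \<Rightarrow> real set" where U: "A \<subseteq> (\<Union>i. U i)" "\<And>i. bounded (U i)"
      and lt: "(\<Sum>i. ennreal (diameter (U i) powr s)) < ennreal (min e (\<delta> powr s))"
      using hausdorff_content_less_cover by blast
    have "diameter (U i) \<le> \<delta>" for i
    proof (rule ccontr)
      assume "\<not> diameter (U i) \<le> \<delta>"
      then have "\<delta> powr s \<le> diameter (U i) powr s" using that s by (intro powr_mono2) auto
      moreover have "ennreal (diameter (U i) powr s) < ennreal (min e (\<delta> powr s))"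
        by (rule ennreal_suminf_lessD[OF lt])
      then have "diameter (U i) powr s < min e (\<delta> powr s)" by (simp add: ennreal_less_iff)
      ultimately show False by simp
    qed
    then have "hausdorff_pre s \<delta> A \<le> (\<Sum>i. ennreal (diameter (U i) powr s))"
      unfolding hausdorff_pre_def using U by (intro Inf_lower) auto
    also have "\<dots> \<le> ennreal (min e (\<delta> powr s))" using lt by simp
    also have "\<dots> \<le> ennreal e" by (intro ennreal_leI) simp
    finally show ?thesis by simp
  qed
  then have "hausdorff_pre s \<delta> A \<le> 0" if "\<delta> > 0" for \<delta>
    using that by (meson ennreal_le_epsilon)
  then show ?thesis unfolding hausdorff_measure_def
    by (metis (no_types, lifting) SUP_least greaterThan_iff le_zero_eq)
qed

lemma hausdorff_measure_eq_0_cover: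
  assumes "hausdorff_measure s A = 0" "\<delta> > 0" "e > 0"
  obtains U :: "nat \<Rightarrow> real set" where "A \<subseteq> (\<Union>i. U i)" "\<And>i. bounded (U i)" "\<And>i. diameter (U i) \<le> \<delta>"
    "(\<Sum>i. ennreal (diameter (U i) powr s)) < e"
proof -
  have "hausdorff_pre s \<delta> A \<le> hausdorff_measure s A"
    unfolding hausdorff_measure_def using assms(2) by (intro SUP_upper) auto
  then have "hausdorff_pre s \<delta> A < e" using assms by simp
  then show thesis unfolding hausdorff_pre_def Inf_less_iff using that by blast
qed

text \<open>Mass distribution principle: replacing each covering set by an interval bounds the mass
  of \<open>A\<close> by \<open>C\<close> times the cost of the cover. Lengths up to 1/2 allow the
  exponent t to be lowered to s.\<close>

lemma hausdorff_null_imp_null: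
  assumes sets: "sets \<mu> = sets borel" and A: "A \<in> sets borel" and null: "hausdorff_measure s A = 0"
    and s0: "0 \<le> s" and st: "s \<le> t" and C: "C \<ge> 0"
    and \<mu>: "\<And>a b. a \<le> b \<Longrightarrow> b - a \<le> 1/2 \<Longrightarrow> emeasure \<mu> {a..b} \<le> ennreal (C * (b - a) powr t)"
  shows "emeasure \<mu> A = 0"
proof -
  have "emeasure \<mu> A \<le> 0 + ennreal e" if e: "e > 0" for e
  proof -
    obtain U :: "nat \<Rightarrow> real set" where U: "A \<subseteq> (\<Union>i. U i)" "\<And>i. bounded (U i)" "\<And>i. diameter (U i) \<le> 1/2"
      and lt: "(\<Sum>i. ennreal (diameter (U i) powr s)) < ennreal (e / (C + 1))"
      by (rule hausdorff_measure_eq_0_cover[OF null, of "1/2" "ennreal (e / (C + 1))"]) (use e C in auto)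
    \<comment> \<open>The covering sets need not be measurable. Their closed interval hulls are, and
      these are no longer than the original diameters.\<close>
    define I where "I = (\<lambda>i. if U i = {} then {} else {Inf (U i)..Sup (U i)})"
    have bdd: "bdd_above (U i)" "bdd_below (U i)" for i
      using U(2)[of i] bounded_imp_bdd_above bounded_imp_bdd_below by auto
    have UI: "U i \<subseteq> I i" for i
      using bdd[of i] by (auto simp: I_def intro: cInf_lower cSup_upper)
    have Im: "emeasure \<mu> (I i) \<le> ennreal C * ennreal (diameter (U i) powr s)" for i
    proof (cases "U i = {}")
      case True
      then show ?thesis by (simp add: I_def)
    next
      case False
      have le: "Sup (U i) - Inf (U i) \<le> diameter (U i)"
      proof -
        have "x \<le> Inf (U i) + diameter (U i)" if x: "x \<in> U i" for x
        proof -
          have "x - diameter (U i) \<le> y" if "y \<in> U i" for y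
            using diameter_bounded_bound[OF U(2) x that] by (simp add: dist_real_def)
          then have "x - diameter (U i) \<le> Inf (U i)" using False by (intro cInf_greatest) auto
          then show ?thesis by simp
        qed
        then have "Sup (U i) \<le> Inf (U i) + diameter (U i)" using False by (intro cSup_least) auto
        then show ?thesis by simp
      qed
      have ge: "Inf (U i) \<le> Sup (U i)" using False bdd[of i] by (intro cInf_le_cSup)
      have "emeasure \<mu> (I i) \<le> ennreal (C * (Sup (U i) - Inf (U i)) powr t)"
        unfolding I_def using False \<mu>[OF ge] le U(3)[of i] by auto
      also have "\<dots> \<le> ennreal (C * diameter (U i) powr s)"
      proof (cases "Sup (U i) - Inf (U i) = 0")
        case False
        define l where "l = Sup (U i) - Inf (U i)"
        have l: "0 < l" "l \<le> diameter (U i)" "l \<le> 1/2" using False le ge U(3)[of i] by (auto simp: l_def)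
        have "l powr t \<le> l powr s" using powr_mono'[OF st, of l] l by auto
        also have "l powr s \<le> diameter (U i) powr s" using l s0 by (intro powr_mono2) auto
        finally have "l powr t \<le> diameter (U i) powr s" .
        then show ?thesis using C by (auto simp: l_def intro!: ennreal_leI mult_left_mono)
      qed (use C in simp)
      finally show ?thesis using C by (simp add: ennreal_mult)
    qed
    have "A \<subseteq> (\<Union>i. I i)" using U(1) UI by blast
    moreover have "I i \<in> sets \<mu>" for i by (simp add: I_def sets)
    ultimately have "emeasure \<mu> A \<le> emeasure \<mu> (\<Union>i. I i)"
      by (intro emeasure_mono sets.countable_UN) auto
    also have "\<dots> \<le> (\<Sum>i. emeasure \<mu> (I i))"
      by (rule emeasure_subadditive_countably) (auto simp: I_def sets)
    also have "\<dots> \<le> (\<Sum>i. ennreal C * ennreal (diameter (U i) powr s))"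
      by (rule suminf_le) (use Im in auto)
    also have "\<dots> = ennreal C * (\<Sum>i. ennreal (diameter (U i) powr s))" by simp
    also have "\<dots> \<le> ennreal C * ennreal (e / (C + 1))" using lt by (intro mult_left_mono) auto
    also have "\<dots> \<le> ennreal e" using e C
      by (simp add: ennreal_mult[symmetric] divide_simps)
    finally show ?thesis by simp
  qed
  then have "emeasure \<mu> A \<le> 0" by (rule ennreal_le_epsilon)
  then show ?thesis by simp
qed

text \<open>A unit interval cut into K equal pieces costs K^(1 - s), which tends to 0; the line is a
  countable union of unit intervals.\<close>

lemma hausdorff_content_UNIV:
  assumes "s > 1"
  shows "hausdorff_content s UNIV = 0"
proof -
  have unit: "hausdorff_content s {a..a+1} = 0" for a :: real
  proof -
    have "hausdorff_content s {a..a+1} \<le> 0 + ennreal e" if e: "e > 0" for e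
    proof -
      have "(\<lambda>n. real (Suc n) powr (1 - s)) \<longlonglongrightarrow> 0"
        using assms by (intro tendsto_neg_powr filterlim_compose[OF filterlim_real_sequentially filterlim_Suc]) auto
      then obtain n where n: "real (Suc n) powr (1 - s) < e"
        using e by (metis (no_types, lifting) eventually_sequentially order_refl order_tendstoD(2))
      define K where "K = real (Suc n)"
      have "{a..a+1} \<subseteq> (\<Union>i\<in>{..n}. {a + real i / K .. a + (real i + 1) / K})"
      proof
        fix x assume x: "x \<in> {a..a+1}"
        \<comment> \<open>The cap at \<open>n\<close> assigns the right endpoint of the interval to
          the last piece.\<close>
        define i where "i = min n (nat \<lfloor>(x - a) * K\<rfloor>)"
        have K: "K > 0" by (simp add: K_def)
        have "real (nat \<lfloor>(x - a) * K\<rfloor>) \<le> (x - a) * K" using x K by (intro of_nat_floor) auto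
        then have "real i \<le> (x - a) * K" unfolding i_def by linarith
        moreover have "(x - a) * K \<le> real i + 1"
        proof (cases "n \<le> nat \<lfloor>(x - a) * K\<rfloor>")
          case True
          then have "K = real i + 1" by (simp add: i_def K_def)
          moreover have "(x - a) * K \<le> 1 * K" using x K by (intro mult_right_mono) auto
          ultimately show ?thesis by linarith
        next
          case False
          then show ?thesis unfolding i_def by linarith
        qed
        ultimately have "x \<in> {a + real i / K .. a + (real i + 1) / K}" using K by (auto simp: field_simps)
        moreover have "i \<le> n" by (simp add: i_def)
        ultimately show "x \<in> (\<Union>i\<in>{..n}. {a + real i / K .. a + (real i + 1) / K})" by auto
      qed
      then have "hausdorff_content s {a..a+1} \<le> hausdorff_content s (\<Union>i\<in>{..n}. {a + real i / K .. a + (real i + 1) / K})"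
        by (rule hausdorff_content_mono)
      also have "\<dots> \<le> of_nat (card {..n}) * ennreal ((1 / K) powr s)"
      proof (rule hausdorff_content_finite_UN_le)
        fix i
        have "diameter {a + real i / K .. a + (real i + 1) / K} = 1 / K"
          by (subst diameter_closed_interval) (auto simp: K_def field_simps)
        then show "hausdorff_content s {a + real i / K .. a + (real i + 1) / K} \<le> ennreal ((1 / K) powr s)"
          using hausdorff_content_le_diameter[of "{a + real i / K .. a + (real i + 1) / K}" s] by simp
      qed simp
      also have "\<dots> = ennreal (K * (1 / K) powr s)"
        by (simp add: K_def ennreal_mult ennreal_of_nat_eq_real_of_nat del: of_nat_Suc)
      also have "K * (1 / K) powr s = K powr (1 - s)"
      proof -
        have K: "K > 0" by (simp add: K_def)
        have 1: "(1 / K) powr s = 1 / K powr s" by (simp only: powr_divide powr_one_eq_one)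
        have 2: "K powr (1 - s) = K / K powr s" using K by (simp only: powr_diff powr_one less_imp_le)
        show ?thesis unfolding 1 2 by (rule times_divide_eq_right[of K 1, unfolded mult_1_right])
      qed
      also have "ennreal \<dots> \<le> ennreal e" using n by (intro ennreal_leI) (simp add: K_def)
      finally show ?thesis by simp
    qed
    then have "hausdorff_content s {a..a+1} \<le> 0" by (rule ennreal_le_epsilon)
    then show ?thesis by simp
  qed
  have "(UNIV :: real set) = (\<Union>n. {of_int (int_decode n)..of_int (int_decode n) + 1})"
  proof -
    have "x \<in> (\<Union>n. {of_int (int_decode n)..of_int (int_decode n) + 1})" for x :: real
      by (rule UN_I[of "int_encode \<lfloor>x\<rfloor>"]) (simp_all add: real_of_int_floor_add_one_ge)
    then show ?thesis by blast
  qed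
  then have "hausdorff_content s UNIV \<le> (\<Sum>n. hausdorff_content s {of_int (int_decode n)..of_int (int_decode n) + 1})"
    using hausdorff_content_UN_le by metis
  then show ?thesis by (simp add: unit)
qed

section \<open>Dimension of sets and lower dimension of measures\<close>

lemma hausdorff_dim_le:
  assumes "s > 0" "hausdorff_content s A = 0"
  shows "hausdorff_dim A \<le> s"
  unfolding hausdorff_dim_def
  by (rule cInf_lower) (use assms hausdorff_measure_eq_0I in \<open>auto intro!: bdd_belowI[of _ 0]\<close>)

text \<open>Supplies an element of the set of exponents defining \<open>hausdorff_dim\<close>, so
  that its infimum is taken over a nonempty set.\<close>

lemma hausdorff_null_2: "hausdorff_measure 2 (A :: real set) = 0"
  using hausdorff_content_UNIV[of 2] hausdorff_content_mono[of A UNIV 2]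
  by (intro hausdorff_measure_eq_0I) auto

lemma hausdorff_dim_nonneg: "hausdorff_dim A \<ge> 0"
  unfolding hausdorff_dim_def by (rule cInf_greatest) (use hausdorff_null_2 in \<open>auto intro: exI[of _ 2]\<close>)

lemma hausdorff_dim_le_1: "hausdorff_dim A \<le> 1"
proof (rule field_le_epsilon)
  fix e :: real assume "e > 0"
  then show "hausdorff_dim A \<le> 1 + e"
    using hausdorff_content_UNIV[of "1 + e"] hausdorff_content_mono[of A UNIV "1 + e"]
    by (intro hausdorff_dim_le) auto
qed

lemma hausdorff_dim_less_imp_null:
  assumes "hausdorff_dim A < t"
  obtains s where "0 < s" "s < t" "hausdorff_measure s A = 0"
proof -
  have "{s. s > 0 \<and> hausdorff_measure s A = 0} \<noteq> {}" using hausdorff_null_2 by (auto intro: exI[of _ 2])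
  from cInf_lessD[OF this assms[unfolded hausdorff_dim_def]] show thesis using that by auto
qed

lemma measure_dim_le:
  assumes "A \<in> sets borel" "emeasure \<theta> A > 0"
  shows "measure_dim \<theta> \<le> hausdorff_dim A"
  unfolding measure_dim_def
  by (rule cInf_lower) (use assms hausdorff_dim_nonneg in \<open>auto intro!: bdd_belowI[of _ 0]\<close>)

lemma measure_dim_less:
  assumes "prob_space \<theta>" "sets \<theta> = sets borel" "measure_dim \<theta> < t"
  obtains A where "A \<in> sets borel" "emeasure \<theta> A > 0" "hausdorff_dim A < t"
proof -
  have "emeasure \<theta> UNIV = 1" using prob_space.emeasure_space_1[OF assms(1)] sets_eq_imp_space_eq[OF assms(2)] by simp
  then have "hausdorff_dim UNIV \<in> {hausdorff_dim A | A. A \<in> sets borel \<and> emeasure \<theta> A > 0}" by force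
  then have "{hausdorff_dim A | A. A \<in> sets borel \<and> emeasure \<theta> A > 0} \<noteq> {}" by blast
  from cInf_lessD[OF this assms(3)[unfolded measure_dim_def]] show thesis using that by auto
qed

lemma measure_dim_le_1:
  assumes "prob_space \<theta>" "sets \<theta> = sets borel"
  shows "measure_dim \<theta> \<le> 1"
proof -
  have "emeasure \<theta> UNIV = 1" using prob_space.emeasure_space_1[OF assms(1)] sets_eq_imp_space_eq[OF assms(2)] by simp
  then have "measure_dim \<theta> \<le> hausdorff_dim UNIV" by (intro measure_dim_le) auto
  then show ?thesis using hausdorff_dim_le_1 order_trans by blast
qed

text \<open>Frostman's criterion: a set of positive mass and dimension below t would be null for
  some exponent s < t, hence of mass zero by the mass distribution principle.\<close>

lemma measure_dim_ge:
  assumes "prob_space \<theta>" "sets \<theta> = sets borel" "C \<ge> 0"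
    and "\<And>a b. a \<le> b \<Longrightarrow> b - a \<le> 1/2 \<Longrightarrow> emeasure \<theta> {a..b} \<le> ennreal (C * (b - a) powr t)"
  shows "measure_dim \<theta> \<ge> t"
proof (rule ccontr)
  assume "\<not> t \<le> measure_dim \<theta>"
  then obtain A where A: "A \<in> sets borel" "emeasure \<theta> A > 0" "hausdorff_dim A < t"
    using measure_dim_less[OF assms(1,2), of t] by auto
  then obtain s where "0 < s" "s < t" "hausdorff_measure s A = 0" using hausdorff_dim_less_imp_null by blast
  then have "emeasure \<theta> A = 0" using hausdorff_null_imp_null[OF assms(2) A(1) _ _ _ assms(3,4), of s] by auto
  with A(2) show False by simp
qed

text \<open>Lebesgue measure satisfies the Frostman bound with exponent 1 and constant 1.\<close>

lemma hausdorff_dim_less_1_imp_lebesgue_null: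
  assumes "A \<in> sets borel" "hausdorff_dim A < 1"
  shows "emeasure lborel A = 0"
proof -
  obtain s where s: "0 < s" "s < 1" "hausdorff_measure s A = 0" using hausdorff_dim_less_imp_null[OF assms(2)] by blast
  show ?thesis by (rule hausdorff_null_imp_null[where s = s and t = 1 and C = 1]) (use s assms in auto)
qed

section \<open>Garsia separation\<close>

text \<open>A geometric series bound, proved along Horner's scheme: D/(1 - |z|) is the fixed point
  of u \<mapsto> D + |z| u.\<close>

lemma poly_bound_in_disc:
  fixes P :: "complex poly"
  assumes "\<And>i. cmod (coeff P i) \<le> D" "cmod z < 1"
  shows "cmod (poly P z) \<le> D / (1 - cmod z)"
  using assms(1)
proof (induction P)
  case 0
  then have "D \<ge> 0" by (metis coeff_0 norm_zero)
  then show ?case using assms(2) by simp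
next
  case (pCons a P)
  have a: "cmod a \<le> D" using pCons.prems[of 0] by simp
  have "cmod (coeff P i) \<le> D" for i using pCons.prems[of "Suc i"] by simp
  then have IH: "cmod (poly P z) \<le> D / (1 - cmod z)" by (rule pCons.IH)
  have "cmod (a + z * poly P z) \<le> D + cmod z * (D / (1 - cmod z))"
    using norm_triangle_ineq[of a "z * poly P z"] a mult_left_mono[OF IH, of "cmod z"]
    by (simp add: norm_mult)
  also have "\<dots> = D / (1 - cmod z)" using assms(2) by (simp add: field_simps)
  finally show ?case by simp
qed

text \<open>The coefficients of the synthetic quotient are the values at z of the shifted tails of
  \<open>P\<close>, and each tail obeys the same coefficient bound.\<close>

lemma synthetic_div_bound:
  fixes P :: "complex poly"
  assumes "\<And>i. cmod (coeff P i) \<le> D" "cmod z < 1"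
  shows "cmod (coeff (synthetic_div P z) k) \<le> D / (1 - cmod z)"
  using assms(1)
proof (induction P arbitrary: k)
  case 0
  then have "D \<ge> 0" by (metis coeff_0 norm_zero)
  then show ?case using assms(2) by simp
next
  case (pCons a P)
  have "cmod (coeff P i) \<le> D" for i using pCons.prems[of "Suc i"] by simp
  then show ?case using pCons.IH[of "k - 1"] poly_bound_in_disc[of P D z] assms(2)
    by (cases k) auto
qed

text \<open>Newton's form of interpolation at the nodes \<open>zs\<close>: the divided differences stay bounded
  because each step sums geometric series in a node of modulus less than 1.\<close>

lemma bounded_division:
  fixes zs :: "complex list"
  assumes "\<And>z. z \<in> set zs \<Longrightarrow> cmod z < 1"
  shows "\<exists>K. \<forall>P. (\<forall>i. cmod (coeff P i) \<le> D) \<longrightarrow>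
    (\<exists>Q R. P = Q * (\<Prod>z\<leftarrow>zs. [:-z, 1:]) + R \<and> degree R \<le> length zs - 1 \<and> (zs = [] \<longrightarrow> R = 0) \<and>
       (\<forall>i. cmod (coeff R i) \<le> K))"
  using assms
proof (induction zs arbitrary: D)
  case Nil
  show ?case by (rule exI[of _ 0]) auto
next
  case (Cons z zs)
  have z: "cmod z < 1" using Cons.prems by auto
  define D1 where "D1 = D / (1 - cmod z)"
  obtain K where K: "\<And>P. (\<forall>i. cmod (coeff P i) \<le> D1) \<Longrightarrow>
    (\<exists>Q R. P = Q * (\<Prod>z\<leftarrow>zs. [:-z, 1:]) + R \<and> degree R \<le> length zs - 1 \<and> (zs = [] \<longrightarrow> R = 0) \<and>
       (\<forall>i. cmod (coeff R i) \<le> K))"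
    using Cons.IH[of D1] Cons.prems by (metis list.set_intros(2))
  show ?case
  \<comment> \<open>Multiplying \<open>R\<close> by the linear factor at most doubles the
    coefficient bound, since |z| < 1; the new constant term P(z) adds at most
    \<open>D1\<close>.\<close>
  proof (rule exI[of _ "2 * K + D1"], intro allI impI)
    fix P :: "complex poly" assume P: "\<forall>i. cmod (coeff P i) \<le> D"
    define P1 where "P1 = synthetic_div P z"
    have "\<forall>i. cmod (coeff P1 i) \<le> D1"
      unfolding P1_def D1_def using synthetic_div_bound[of P D z] P z by auto
    from K[OF this] obtain Q R where QR: "P1 = Q * (\<Prod>z\<leftarrow>zs. [:-z, 1:]) + R"
      "degree R \<le> length zs - 1" "zs = [] \<longrightarrow> R = 0" "\<forall>i. cmod (coeff R i) \<le> K" by blast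
    have Pz: "cmod (poly P z) \<le> D1" unfolding D1_def using poly_bound_in_disc[of P D z] P z by auto
    have K0: "K \<ge> 0" using QR(4) norm_ge_zero order_trans by blast
    define R' where "R' = [:-z, 1:] * R + [:poly P z:]"
    have "P = [:-z, 1:] * P1 + [:poly P z:]"
      using synthetic_div_correct'[of z P] by (simp add: P1_def)
    then have "P = Q * (\<Prod>z\<leftarrow>z # zs. [:-z, 1:]) + R'"
      by (simp add: QR(1) R'_def algebra_simps)
    \<comment> \<open>Truncated subtraction makes the degree bound read 0 for an empty list, where
      the remainder must vanish altogether; the clause \<open>R = 0\<close> handles this
      case.\<close>
    moreover have "degree R' \<le> length (z # zs) - 1"
    proof (cases "zs = []")
      case True
      then show ?thesis using QR(3) by (simp add: R'_def)
    next
      case False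
      then have "degree ([:-z, 1:] * R) \<le> length zs"
        using QR(2) degree_mult_le[of "[:-z, 1:]" R]
        by (cases zs) auto
      then show ?thesis unfolding R'_def by (auto intro!: degree_add_le)
    qed
    moreover have "cmod (coeff R' i) \<le> 2 * K + D1" for i
    proof -
      have 1: "cmod (coeff ([:-z, 1:] * R) i) \<le> 2 * K"
      proof -
        have a: "coeff ([:-z, 1:] * R) i = - z * coeff R i + (if i = 0 then 0 else coeff R (i - 1))"
          by (cases i) (auto simp: coeff_pCons)
        have "cmod (- z * coeff R i) \<le> 1 * K"
          unfolding norm_mult using QR(4) z K0 by (intro mult_mono) auto
        moreover have "cmod (if i = 0 then 0 else coeff R (i - 1)) \<le> K" using QR(4) K0 by auto
        ultimately show ?thesis unfolding a
          using norm_triangle_ineq[of "- z * coeff R i" "if i = 0 then 0 else coeff R (i - 1)"] by linarith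
      qed
      have "0 \<le> D1" using Pz norm_ge_zero order_trans by blast
      then have 2: "cmod (coeff [:poly P z:] i) \<le> D1" using Pz by (cases i) auto
      show ?thesis unfolding R'_def coeff_add
        using norm_triangle_ineq[of "coeff ([:-z, 1:] * R) i" "coeff [:poly P z:] i"] 1 2 by linarith
    qed
    ultimately show "\<exists>Q R. P = Q * (\<Prod>z\<leftarrow>z # zs. [:-z, 1:]) + R \<and> degree R \<le> length (z # zs) - 1 \<and>
       (z # zs = [] \<longrightarrow> R = 0) \<and> (\<forall>i. cmod (coeff R i) \<le> 2 * K + D1)"
      by blast
  qed
qed

section \<open>Roots of irreducible integer polynomials\<close>

lemma map_poly_of_int_add: "map_poly of_int (p + q :: int poly) = (map_poly of_int p + map_poly of_int q :: 'a::comm_ring_1 poly)"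
  by (rule poly_eqI) (simp add: coeff_map_poly)

lemma map_poly_of_int_mult: "map_poly of_int (p * q :: int poly) = (map_poly of_int p * map_poly of_int q :: 'a::comm_ring_1 poly)"
  by (rule poly_eqI) (simp add: coeff_map_poly coeff_mult)

text \<open>Descent by pseudo-division, which stays within integer polynomials: the remainder of
  \<open>p\<close> by \<open>r\<close> shares the root and has smaller degree, so it is 0 and a
  nonzero multiple of \<open>p\<close> equals \<open>r * q\<close>. As \<open>p\<close> is prime and
  too large to divide \<open>r\<close>, it divides \<open>q\<close>; then \<open>r\<close> is a
  nonzero constant and has no root.\<close>

lemma irreducible_int_poly_lower_degree_no_root:
  fixes p r :: "int poly" and x :: "'a::field_char_0"
  assumes p: "irreducible p" and r: "r \<noteq> 0" "degree r < degree p"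
    and px: "poly (map_poly of_int p) x = 0"
  shows "poly (map_poly of_int r) x \<noteq> 0"
  using r
proof (induction "degree r" arbitrary: r rule: less_induct)
  case less
  show ?case
  proof
    assume rx: "poly (map_poly of_int r) x = 0"
    obtain q s where qs: "pseudo_divmod p r = (q, s)" by fastforce
    define c where "c = coeff r (degree r) ^ (Suc (degree p) - degree r)"
    have eq: "smult c p = r * q + s" and s: "s = 0 \<or> degree s < degree r"
      using pseudo_divmod[OF less.prems(1) qs] unfolding c_def by auto
    have c0: "c \<noteq> 0" using less.prems(1) by (simp add: c_def)
    have "poly (map_poly of_int ([:c:] * p)) x = poly (map_poly of_int (r * q + s)) x"
      using eq by simp
    then have "poly (map_poly of_int s) x = 0"
      by (simp only: map_poly_of_int_add map_poly_of_int_mult poly_add poly_mult px rx) simp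
    then have "s = 0" using less.hyps[of s] s less.prems(2) by auto
    with eq have eq: "smult c p = r * q" by simp
    have "p dvd r * q" by (metis eq dvd_smult dvd_refl)
    with irreducible_imp_prime_poly[OF p] have "p dvd r \<or> p dvd q"
      by (simp add: prime_elem_dvd_mult_iff)
    moreover have "\<not> p dvd r" using less.prems by (meson dvd_imp_degree_le linorder_not_le)
    ultimately obtain u where "q = p * u" by (auto elim: dvdE)
    with eq have "p * [:c:] = p * (r * u)" by (simp add: mult_ac)
    moreover have "p \<noteq> 0" using p by auto
    ultimately have ru: "[:c:] = r * u" using mult_left_cancel by blast
    then have "degree r = 0" using c0
      by (metis degree_mult_eq_0 degree_pCons_0 mult_eq_0_iff pCons_eq_0_iff)
    then obtain a where "r = [:a:]" by (auto elim: degree_eq_zeroE)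
    with rx less.prems(1) show False by (simp add: map_poly_pCons)
  qed
qed

text \<open>The derivative is a nonzero integer polynomial of lower degree, so it cannot share a
  root with \<open>p\<close>.\<close>

lemma irreducible_int_poly_simple_root:
  fixes p :: "int poly" and x :: "'a::field_char_0"
  assumes p: "irreducible p" "degree p > 0"
    and px: "poly (map_poly of_int p) x = 0"
  shows "poly (pderiv (map_poly of_int p)) x \<noteq> 0"
proof -
  have "pderiv (map_poly of_int p) = (map_poly of_int (pderiv p) :: 'a poly)"
    by (rule poly_eqI) (simp add: coeff_pderiv coeff_map_poly)
  moreover have "pderiv p \<noteq> 0" using p(2) by (simp add: pderiv_eq_0_iff)
  moreover have "degree (pderiv p) < degree p" using p(2) by (simp add: degree_pderiv)
  ultimately show ?thesis using irreducible_int_poly_lower_degree_no_root[OF p(1) _ _ px] by metis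
qed

lemma finite_int_poly_bounded:
  "finite {R :: int poly. degree R < n \<and> (\<forall>i. \<bar>coeff R i\<bar> \<le> K)}"
proof -
  have "finite {xs :: int list. set xs \<subseteq> {-K..K} \<and> length xs \<le> n}"
    by (rule finite_lists_length_le) simp
  moreover have "{R :: int poly. degree R < n \<and> (\<forall>i. \<bar>coeff R i\<bar> \<le> K)} \<subseteq>
    Poly ` {xs :: int list. set xs \<subseteq> {-K..K} \<and> length xs \<le> n}"
  proof
    fix R :: "int poly" assume R: "R \<in> {R. degree R < n \<and> (\<forall>i. \<bar>coeff R i\<bar> \<le> K)}"
    have "length (coeffs R) \<le> n" using R by (simp add: length_coeffs)
       (metis One_nat_def Suc_leI coeffs_eq_Nil length_coeffs_degree list.size(3) zero_le)
    moreover have "set (coeffs R) \<subseteq> {-K..K}"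
    proof
      fix a assume "a \<in> set (coeffs R)"
      then obtain i where "a = coeff R i" by (metis in_set_conv_nth coeffs_nth length_coeffs_degree
          le_imp_less_Suc less_Suc_eq_le coeffs_eq_Nil list.size(3) not_less_zero)
      then show "a \<in> {-K..K}" using R by (simp add: abs_le_iff minus_le_iff)
    qed
    ultimately show "R \<in> Poly ` {xs :: int list. set xs \<subseteq> {-K..K} \<and> length xs \<le> n}"
      by (intro image_eqI[of _ _ "coeffs R"]) auto
  qed
  ultimately show ?thesis by (rule finite_surj)
qed


section \<open>Sums with bounded integer digits and their separation\<close>

text \<open>Index 0 is the least significant digit, so the numerator is an integer polynomial
  evaluated at \<beta>. Digits may be negative, which keeps differences of such sums in the same
  form.\<close>

definition beta_sums :: "real \<Rightarrow> nat \<Rightarrow> int \<Rightarrow> real set" where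
  "beta_sums \<beta> N D = {x. \<exists>d :: nat \<Rightarrow> int. (\<forall>i. \<bar>d i\<bar> \<le> D) \<and> x = (\<Sum>i<N. of_int (d i) * \<beta> ^ i) / \<beta> ^ N}"

lemma poly_of_real_int:
  "poly (map_poly of_int (p :: int poly)) (complex_of_real x) = complex_of_real (poly (map_poly of_int p) x)"
  by (induction p) (auto simp: map_poly_pCons)

text \<open>The integer remainder of \<open>P\<close> modulo the monic minimal polynomial has the
  same value at \<beta>. Its coefficients are bounded independently of \<open>degree P\<close>: it
  agrees with the complex remainder obtained by interpolating at the conjugates inside the unit disc
  and finally at \<beta>, where the value is at most 1 in modulus.\<close>

lemma pisot_remainder_bounded:
  assumes "pisot \<beta>"
  obtains n :: nat and K :: int where
    "\<And>P :: int poly. (\<forall>i. \<bar>coeff P i\<bar> \<le> D) \<Longrightarrow> \<bar>poly (map_poly of_int P) \<beta>\<bar> \<le> 1 \<Longrightarrow>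
       \<exists>R :: int poly. degree R < n \<and> (\<forall>i. \<bar>coeff R i\<bar> \<le> K) \<and>
         poly (map_poly of_int R) \<beta> = (poly (map_poly of_int P) \<beta> :: real)"
proof -
  obtain p :: "int poly" where b1: "\<beta> > 1" and p: "lead_coeff p = 1" "irreducible p"
    and root: "poly (map_poly of_int p) \<beta> = 0"
    and conj: "\<And>z :: complex. poly (map_poly of_int p) z = 0 \<Longrightarrow> z \<noteq> complex_of_real \<beta> \<Longrightarrow> cmod z < 1"
    using assms unfolding pisot_def by blast
  have deg: "degree p > 0"
  proof (rule ccontr)
    assume "\<not> degree p > 0"
    then obtain a where "p = [:a:]" by (auto elim: degree_eq_zeroE)
    with p(1) root show False by (simp add: map_poly_pCons)
  qed
  define b where "b = complex_of_real \<beta>"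
  define pc where "pc = (map_poly of_int p :: complex poly)"
  have pcb: "poly pc b = 0" unfolding pc_def b_def poly_of_real_int root by simp
  have degpc: "degree pc = degree p" unfolding pc_def by (rule degree_map_poly) auto
  have lead: "lead_coeff pc = 1" unfolding degpc using p(1) by (simp add: pc_def coeff_map_poly)
  then have pc0: "pc \<noteq> 0" by auto
  obtain A where A: "size A = degree pc" "pc = (\<Prod>x\<in>#A. [:-x, 1:])"
    using alg_closed_imp_factorization[OF pc0] lead by auto
  have "b \<in># A" using pcb unfolding A(2) by (induction A) auto
  then obtain A' where A': "A = add_mset b A'" by (meson mset_add)
  obtain zs where zs: "mset zs = A'" using ex_mset by blast
  define q where "q = (\<Prod>z\<leftarrow>zs. [:-z, 1:])"
  have pcq: "pc = [:-b, 1:] * q" unfolding A(2) A' q_def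
    by (simp add: zs[symmetric] flip: prod_mset_prod_list)
  have len: "degree p = Suc (length zs)" using A(1) by (simp add: degpc A' zs[symmetric])
  \<comment> \<open>The derivative of \<open>pc\<close> at \<open>b\<close> equals
    \<open>poly q b\<close>. Hence \<beta> is not a root of \<open>q\<close>, and all nodes in
    \<open>zs\<close> are other conjugates, of modulus below 1.\<close>
  have "poly (pderiv pc) b \<noteq> 0" unfolding pc_def
    by (rule irreducible_int_poly_simple_root[OF p(2) deg]) (use pcb pc_def in simp)
  then have qb: "poly q b \<noteq> 0" unfolding pcq pderiv_mult by (simp add: pderiv_pCons del: mult_pCons_left)
  have qz: "z \<in> set zs \<Longrightarrow> poly q z = 0" for z unfolding q_def by (induction zs) auto
  have small: "cmod z < 1" if "z \<in> set zs" for z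
    using conj[of z] qz[OF that] qb unfolding pc_def[symmetric] b_def[symmetric] pcq by auto
  have q0: "q \<noteq> 0" using qb by auto
  have degq: "degree q = length zs" using len degpc pcq q0 by (simp add: degree_mult_eq del: mult_pCons_left)
  obtain K where K: "\<And>P. (\<forall>i. cmod (coeff P i) \<le> of_int D) \<Longrightarrow>
    (\<exists>Q R. P = Q * q + R \<and> degree R \<le> length zs - 1 \<and> (zs = [] \<longrightarrow> R = 0) \<and>
       (\<forall>i. cmod (coeff R i) \<le> K))"
    using bounded_division[OF small, of zs "of_int D"] unfolding q_def[symmetric] by blast
  define n where "n = degree p"
  define Kb where "Kb = (\<Sum>i\<le>length zs. K * \<beta> ^ i)"
  define Cq where "Cq = (\<Sum>i\<le>length zs. cmod (coeff q i))"
  \<comment> \<open>Bounds the coefficients of Q(b) q + R: since Q(b) q(b) = P(b) - R(b), |P(b)| is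
    at most 1 and |R(b)| at most \<open>Kb\<close>, the factor Q(b) is controlled.\<close>
  define K' where "K' = (1 + Kb) / cmod (poly q b) * Cq + K"
  show ?thesis
  proof (rule that[of n "\<lfloor>K'\<rfloor>"])
    fix P :: "int poly"
    assume P: "\<forall>i. \<bar>coeff P i\<bar> \<le> D" and P1: "\<bar>poly (map_poly of_int P) \<beta>\<bar> \<le> 1"
    define Pc where "Pc = (map_poly of_int P :: complex poly)"
    have "\<forall>i. cmod (coeff Pc i) \<le> of_int D"
      using P by (simp add: Pc_def coeff_map_poly flip: of_int_abs)
    from K[OF this] obtain Q R where QR: "Pc = Q * q + R" "degree R \<le> length zs - 1" "zs = [] \<longrightarrow> R = 0"
      "\<And>i. cmod (coeff R i) \<le> K" by blast
    \<comment> \<open>Last interpolation step, at the node \<open>b\<close> outside the unit disc: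
      here the bound on P(b) replaces the geometric series.\<close>
    define Q2 where "Q2 = synthetic_div Q b"
    have Q2: "Q = [:-b, 1:] * Q2 + [:poly Q b:]"
      using synthetic_div_correct'[of b Q] by (simp add: Q2_def)
    define S where "S = smult (poly Q b) q + R"
    have PcS: "Pc = Q2 * pc + S" unfolding QR(1) S_def pcq
      by (subst Q2) (simp add: algebra_simps)
    have degR: "degree R \<le> length zs" using QR(2) by simp
    have degS: "degree S < n" unfolding S_def n_def len less_Suc_eq_le
      by (rule degree_add_le) (use degR degq degree_smult_le[of "poly Q b" q] in auto)
    have K0: "K \<ge> 0" using QR(4)[of 0] norm_ge_zero order_trans by blast
    have Rb: "cmod (poly R b) \<le> Kb"
    proof -
      have "poly R b = (\<Sum>i\<le>degree R. coeff R i * b ^ i)" by (rule poly_altdef)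
      also have "\<dots> = (\<Sum>i\<le>length zs. coeff R i * b ^ i)"
        by (rule sum.mono_neutral_left) (use degR in \<open>auto simp: coeff_eq_0\<close>)
      also have "cmod \<dots> \<le> Kb" unfolding Kb_def
        by (rule sum_norm_le) (use QR(4) b1 in \<open>auto simp: b_def norm_mult norm_power intro!: mult_right_mono\<close>)
      finally show ?thesis .
    qed
    have Pb: "cmod (poly Pc b) \<le> 1" unfolding Pc_def b_def poly_of_real_int using P1 by simp
    have "poly Q b * poly q b = poly Pc b - poly R b" by (simp add: QR(1))
    then have "cmod (poly Q b) * cmod (poly q b) \<le> 1 + Kb"
      using norm_triangle_ineq4[of "poly Pc b" "poly R b"] Pb Rb by (metis norm_mult add_mono order_trans)
    then have Qb: "cmod (poly Q b) \<le> (1 + Kb) / cmod (poly q b)"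
      using qb by (simp add: field_simps)
    have cq: "cmod (coeff q i) \<le> Cq" for i
    proof (cases "i \<le> length zs")
      case True
      then show ?thesis unfolding Cq_def by (intro member_le_sum) auto
    next
      case False
      then show ?thesis unfolding Cq_def by (simp add: coeff_eq_0 degq sum_nonneg)
    qed
    have S: "cmod (coeff S i) \<le> K'" for i
    proof -
      have "cmod (poly Q b * coeff q i) \<le> (1 + Kb) / cmod (poly q b) * Cq"
        unfolding norm_mult using Qb cq by (intro mult_mono) (auto intro: order_trans[OF norm_ge_zero])
      then show ?thesis unfolding S_def K'_def coeff_add coeff_smult
        using norm_triangle_ineq[of "poly Q b * coeff q i" "coeff R i"] QR(4)[of i] by linarith
    qed
    obtain u s where us: "pseudo_divmod P p = (u, s)" by fastforce
    have p0: "p \<noteq> 0" using deg by auto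
    have Pus: "P = p * u + s" and s: "s = 0 \<or> degree s < degree p"
      using pseudo_divmod[OF p0 us] p(1) by auto
    then have degs: "degree s < n" using deg by (auto simp: n_def)
    define uc where "uc = (map_poly of_int u :: complex poly)"
    define sc where "sc = (map_poly of_int s :: complex poly)"
    have "Pc = pc * uc + sc" unfolding Pc_def pc_def uc_def sc_def Pus
      by (simp add: map_poly_of_int_add map_poly_of_int_mult)
    then have eq: "pc * (Q2 - uc) = sc - S" using PcS by (simp add: algebra_simps)
    have degsc: "degree sc < n" using degs by (simp add: sc_def degree_map_poly)
    \<comment> \<open>Uniqueness of remainders: \<open>sc\<close> and \<open>S\<close> have degree
      below that of \<open>pc\<close>, so a multiple of \<open>pc\<close> equal to their difference
      is zero.\<close>
    have "Q2 - uc = 0"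
    proof (rule ccontr)
      assume "Q2 - uc \<noteq> 0"
      then have "degree (sc - S) \<ge> n" unfolding eq[symmetric] using pc0
        by (simp add: degree_mult_eq degpc n_def)
      moreover have "degree (sc - S) < n" by (rule degree_diff_less) fact+
      ultimately show False by simp
    qed
    then have "sc = S" using eq by simp
    then have "cmod (coeff sc i) \<le> K'" for i using S by simp
    then have "\<bar>coeff s i\<bar> \<le> \<lfloor>K'\<rfloor>" for i
      by (simp add: sc_def coeff_map_poly le_floor_iff)
    moreover have "poly (map_poly of_int s) \<beta> = poly (map_poly of_int P) \<beta>"
      unfolding Pus by (simp add: map_poly_of_int_add map_poly_of_int_mult root)
    ultimately show "\<exists>R :: int poly. degree R < n \<and> (\<forall>i. \<bar>coeff R i\<bar> \<le> \<lfloor>K'\<rfloor>) \<and>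
         poly (map_poly of_int R) \<beta> = poly (map_poly of_int P) \<beta>"
      using degs by blast
  qed
qed

text \<open>Garsia's lemma. The number x \<beta>^N is the value at \<beta> of an integer polynomial
  with bounded coefficients; if it is at most 1 in modulus, it is one of the finitely many values of
  the bounded remainders. The least nonzero modulus serves as the constant.\<close>

lemma pisot_separation:
  assumes "pisot \<beta>"
  obtains c where "c > 0" "\<And>N x. x \<in> beta_sums \<beta> N D \<Longrightarrow> x \<noteq> 0 \<Longrightarrow> \<bar>x\<bar> \<ge> c / \<beta> ^ N"
proof -
  have b1: "\<beta> > 1" using assms by (simp add: pisot_def)
  obtain n K where nK: "\<And>P :: int poly. (\<forall>i. \<bar>coeff P i\<bar> \<le> D) \<Longrightarrow> \<bar>poly (map_poly of_int P) \<beta>\<bar> \<le> 1 \<Longrightarrow>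
       \<exists>R :: int poly. degree R < n \<and> (\<forall>i. \<bar>coeff R i\<bar> \<le> K) \<and>
         poly (map_poly of_int R) \<beta> = (poly (map_poly of_int P) \<beta> :: real)"
    using pisot_remainder_bounded[OF assms] by metis
  \<comment> \<open>The inserted 1 makes \<open>F\<close> nonempty and covers the values of modulus
    above 1.\<close>
  define F where "F = insert 1 ((\<lambda>R. \<bar>poly (map_poly of_int R) \<beta>\<bar>) `
     {R :: int poly. degree R < n \<and> (\<forall>i. \<bar>coeff R i\<bar> \<le> K)} - {0})"
  have F: "finite F" "F \<noteq> {}" unfolding F_def using finite_int_poly_bounded by auto
  have pos: "\<forall>x\<in>F. x > 0" by (auto simp: F_def)
  show ?thesis
  proof (rule that[of "Min F"])
    show "Min F > 0" using F pos by simp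
    fix N x assume x: "x \<in> beta_sums \<beta> N D" "x \<noteq> 0"
    then obtain d :: "nat \<Rightarrow> int" where d: "\<forall>i. \<bar>d i\<bar> \<le> D" and
      xd: "x = (\<Sum>i<N. of_int (d i) * \<beta> ^ i) / \<beta> ^ N" unfolding beta_sums_def by blast
    define P where "P = (\<Sum>i<N. monom (d i) i)"
    have cP: "coeff P i = (if i < N then d i else 0)" for i
      unfolding P_def by (simp add: coeff_sum)
    have "D \<ge> 0" using d abs_ge_zero order_trans by blast
    then have P: "\<forall>i. \<bar>coeff P i\<bar> \<le> D" using d by (simp add: cP)
    have "map_poly of_int P = (\<Sum>i<N. monom (of_int (d i)) i :: real poly)"
      by (rule poly_eqI) (simp add: coeff_map_poly cP coeff_sum)
    then have Pb: "poly (map_poly of_int P) \<beta> = x * \<beta> ^ N"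
      unfolding xd using b1 by (simp add: poly_sum poly_monom)
    have "\<bar>x * \<beta> ^ N\<bar> \<ge> Min F"
    proof (cases "\<bar>x * \<beta> ^ N\<bar> \<le> 1")
      case True
      then obtain R where R: "degree R < n" "\<forall>i. \<bar>coeff R i\<bar> \<le> K" "poly (map_poly of_int R) \<beta> = x * \<beta> ^ N"
        using nK[OF P] Pb by metis
      have "\<bar>poly (map_poly of_int R) \<beta>\<bar> \<in> F" unfolding F_def
        by (rule insertI2, rule DiffI, rule imageI) (use R x b1 in auto)
      then show ?thesis using R F by simp
    next
      case False
      have "Min F \<le> 1" using F by (simp add: F_def)
      then show ?thesis using False by simp
    qed
    then show "\<bar>x\<bar> \<ge> Min F / \<beta> ^ N" using b1 by (simp add: abs_mult field_simps)
  qed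
qed

section \<open>Truncated beta expansions\<close>

text \<open>Cells of length d contain at most one point each, so the cell number is injective on
  \<open>S\<close>.\<close>

lemma separated_card_le:
  fixes S :: "real set"
  assumes S: "S \<subseteq> {a..b}" and d: "d > 0"
    and sep: "\<And>x y. x \<in> S \<Longrightarrow> y \<in> S \<Longrightarrow> x \<noteq> y \<Longrightarrow> \<bar>x - y\<bar> \<ge> d"
  shows "finite S" "a \<le> b \<Longrightarrow> real (card S) \<le> (b - a) / d + 1"
proof -
  define f where "f = (\<lambda>x. nat \<lfloor>(x - a) / d\<rfloor>)"
  have nn: "(x - a) / d \<ge> 0" if "x \<in> S" for x using S d that by auto
  have inj: "inj_on f S"
  proof (rule inj_onI, rule ccontr)
    fix x y assume xy: "x \<in> S" "y \<in> S" "f x = f y" "x \<noteq> y"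
    then have "\<lfloor>(x - a) / d\<rfloor> = \<lfloor>(y - a) / d\<rfloor>" using nn[of x] nn[of y] unfolding f_def
      by (metis eq_nat_nat_iff zero_le_floor)
    then have "\<bar>(x - a) / d - (y - a) / d\<bar> < 1" by linarith
    then have "\<bar>x - y\<bar> < d" using d by (simp add: diff_divide_distrib[symmetric] abs_divide divide_simps)
    with sep[OF xy(1,2,4)] show False by simp
  qed
  have sub: "f ` S \<subseteq> {.. nat \<lfloor>(b - a) / d\<rfloor>}"
    using S d by (auto simp: f_def intro!: nat_mono floor_mono divide_right_mono)
  show "finite S" using inj sub by (meson finite_atMost finite_imageD finite_subset)
  assume "a \<le> b"
  have "card S \<le> card {.. nat \<lfloor>(b - a) / d\<rfloor>}" using inj sub by (meson card_inj_on_le finite_atMost)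
  then have "real (card S) \<le> real (nat \<lfloor>(b - a) / d\<rfloor>) + 1" by simp
  moreover have "real (nat \<lfloor>(b - a) / d\<rfloor>) \<le> (b - a) / d" using \<open>a \<le> b\<close> d by (intro of_nat_floor) simp
  ultimately show "real (card S) \<le> (b - a) / d + 1" by simp
qed

section \<open>The beta map and its truncations\<close>

lemma beta_map_measurable [measurable]: "beta_map \<beta> \<in> borel_measurable borel"
  unfolding beta_map_def[abs_def] frac_def by measurable

lemma funpow_beta_map_measurable [measurable]: "(beta_map \<beta> ^^ N) \<in> borel_measurable borel"
proof (induction N)
  case 0
  then show ?case by (simp add: id_def)
next
  case (Suc N)
  then show ?case by (simp add: comp_def) measurable
qed

lemma beta_map_range: "0 \<le> beta_map \<beta> x" "beta_map \<beta> x < 1"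
  by (simp_all add: beta_map_def frac_lt_1)

lemma funpow_beta_map_range:
  "0 \<le> x \<Longrightarrow> x < 1 \<Longrightarrow> 0 \<le> (beta_map \<beta> ^^ N) x \<and> (beta_map \<beta> ^^ N) x < 1"
  by (induction N) (auto simp: beta_map_range)

text \<open>For x in [0,1) and \<beta> > 1 this is the sum of the first \<open>N\<close> terms of
  the greedy \<beta>-expansion, written as x minus its rescaled remainder.\<close>

definition beta_trunc :: "real \<Rightarrow> nat \<Rightarrow> real \<Rightarrow> real" where
  "beta_trunc \<beta> N x = x - (beta_map \<beta> ^^ N) x / \<beta> ^ N"

lemma beta_trunc_measurable [measurable]: "beta_trunc \<beta> N \<in> borel_measurable borel"
  unfolding beta_trunc_def[abs_def] by measurable

text \<open>Cocycle rule: after the first \<open>N\<close> digits of x come the digits of its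
  \<open>N\<close>-th iterate.\<close>

lemma beta_trunc_add:
  "beta_trunc \<beta> (N + M) x = beta_trunc \<beta> N x + beta_trunc \<beta> M ((beta_map \<beta> ^^ N) x) / \<beta> ^ N"
proof -
  have "(beta_map \<beta> ^^ (N + M)) x = (beta_map \<beta> ^^ M) ((beta_map \<beta> ^^ N) x)"
    by (subst add.commute) (simp add: funpow_add)
  then show ?thesis
    unfolding beta_trunc_def by (simp only: power_add diff_divide_distrib divide_divide_eq_left')
qed

lemma beta_sums_plus:
  assumes "x \<in> beta_sums \<beta> N D" "y \<in> beta_sums \<beta> N D'"
  shows "x + y \<in> beta_sums \<beta> N (D + D')"
proof -
  obtain d d' :: "nat \<Rightarrow> int" where "\<forall>i. \<bar>d i\<bar> \<le> D" "x = (\<Sum>i<N. of_int (d i) * \<beta> ^ i) / \<beta> ^ N"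
    "\<forall>i. \<bar>d' i\<bar> \<le> D'" "y = (\<Sum>i<N. of_int (d' i) * \<beta> ^ i) / \<beta> ^ N"
    using assms unfolding beta_sums_def by auto
  moreover from this have "\<bar>d i + d' i\<bar> \<le> D + D'" for i
    by (meson abs_triangle_ineq add_mono order_trans)
  ultimately show ?thesis unfolding beta_sums_def
    by (intro CollectI exI[of _ "\<lambda>i. d i + d' i"])
       (auto simp: add_divide_distrib sum.distrib distrib_right)
qed

lemma beta_sums_minus:
  assumes "x \<in> beta_sums \<beta> N D"
  shows "- x \<in> beta_sums \<beta> N D"
proof -
  obtain d :: "nat \<Rightarrow> int" where "\<forall>i. \<bar>d i\<bar> \<le> D" "x = (\<Sum>i<N. of_int (d i) * \<beta> ^ i) / \<beta> ^ N"
    using assms unfolding beta_sums_def by auto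
  then show ?thesis unfolding beta_sums_def
    by (intro CollectI exI[of _ "\<lambda>i. - d i"]) (auto simp: sum_negf)
qed

lemma beta_sums_concat:
  assumes "x \<in> beta_sums \<beta> N D" "y \<in> beta_sums \<beta> M D" "\<beta> > 0"
  shows "x + y / \<beta> ^ N \<in> beta_sums \<beta> (N + M) D"
proof -
  obtain d e :: "nat \<Rightarrow> int" where d: "\<forall>i. \<bar>d i\<bar> \<le> D" "x = (\<Sum>i<N. of_int (d i) * \<beta> ^ i) / \<beta> ^ N"
    and e: "\<forall>i. \<bar>e i\<bar> \<le> D" "y = (\<Sum>i<M. of_int (e i) * \<beta> ^ i) / \<beta> ^ M"
    using assms unfolding beta_sums_def by auto
  \<comment> \<open>The digits of y come later in the expansion, hence occupy the low
    indices.\<close>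
  define f where "f = (\<lambda>i. if i < M then e i else d (i - M))"
  have "(\<Sum>i<N+M. of_int (f i) * \<beta> ^ i) = (\<Sum>i<M. of_int (e i) * \<beta> ^ i) + \<beta> ^ M * (\<Sum>i<N. of_int (d i) * \<beta> ^ i)"
  proof -
    have "(\<Sum>i<N+M. of_int (f i) * \<beta> ^ i) = (\<Sum>i<M. of_int (f i) * \<beta> ^ i) + (\<Sum>i<N. of_int (f (M + i)) * \<beta> ^ (M + i))"
      by (induction N) (auto simp: add.commute[of M])
    then show ?thesis by (simp add: f_def sum_distrib_left power_add mult_ac)
  qed
  then have "x + y / \<beta> ^ N = (\<Sum>i<N+M. of_int (f i) * \<beta> ^ i) / \<beta> ^ (N + M)"
    using assms(3) unfolding d(2) e(2) by (simp only: power_add add_divide_distrib) simp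
  moreover have "\<forall>i. \<bar>f i\<bar> \<le> D" using d e by (simp add: f_def)
  ultimately show ?thesis unfolding beta_sums_def by blast
qed

lemma beta_sums_0: "D \<ge> 0 \<Longrightarrow> 0 \<in> beta_sums \<beta> N D"
  unfolding beta_sums_def by (intro CollectI exI[of _ "\<lambda>i. 0"]) auto

lemma beta_trunc_1:
  assumes "\<beta> > 1" "0 \<le> x" "x < 1"
  shows "beta_trunc \<beta> 1 x = \<lfloor>\<beta> * x\<rfloor> / \<beta>" "0 \<le> \<lfloor>\<beta> * x\<rfloor>" "\<lfloor>\<beta> * x\<rfloor> \<le> \<lceil>\<beta>\<rceil>"
proof -
  show "beta_trunc \<beta> 1 x = \<lfloor>\<beta> * x\<rfloor> / \<beta>"
    using assms by (simp add: beta_trunc_def beta_map_def frac_def field_simps)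
  show "0 \<le> \<lfloor>\<beta> * x\<rfloor>" using assms by simp
  have "\<beta> * x \<le> \<beta>" using assms by (simp add: mult_left_le)
  then show "\<lfloor>\<beta> * x\<rfloor> \<le> \<lceil>\<beta>\<rceil>" by linarith
qed

lemma beta_trunc_in_beta_sums:
  assumes "\<beta> > 1" "0 \<le> x" "x < 1"
  shows "beta_trunc \<beta> N x \<in> beta_sums \<beta> N \<lceil>\<beta>\<rceil> \<and> 0 \<le> beta_trunc \<beta> N x"
proof (induction N)
  case 0
  have "0 \<le> \<lceil>\<beta>\<rceil>" using assms(1) by linarith
  then show ?case by (simp add: beta_trunc_def beta_sums_0)
next
  case (Suc N)
  define y where "y = (beta_map \<beta> ^^ N) x"
  have y: "0 \<le> y" "y < 1" using funpow_beta_map_range[OF assms(2,3)] by (auto simp: y_def)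
  note t = beta_trunc_1[OF assms(1) y]
  have "beta_trunc \<beta> 1 y \<in> beta_sums \<beta> 1 \<lceil>\<beta>\<rceil>"
    unfolding t(1) beta_sums_def
    by (intro CollectI exI[of _ "\<lambda>i. \<lfloor>\<beta> * y\<rfloor>"]) (use t in auto)
  then have "beta_trunc \<beta> N x + beta_trunc \<beta> 1 y / \<beta> ^ N \<in> beta_sums \<beta> (N + 1) \<lceil>\<beta>\<rceil>"
    using Suc assms by (intro beta_sums_concat) auto
  moreover have "beta_trunc \<beta> 1 y / \<beta> ^ N \<ge> 0" unfolding t(1) using t(2) assms by simp
  ultimately show ?case using Suc beta_trunc_add[of \<beta> N 1 x] by (simp add: y_def)
qed

lemma beta_trunc_bounds:
  assumes "\<beta> > 1" "0 \<le> x" "x < 1"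
  shows "beta_trunc \<beta> N x \<le> x" "x - 1 / \<beta> ^ N < beta_trunc \<beta> N x"
proof -
  note r = funpow_beta_map_range[OF assms(2,3), of N \<beta>]
  show "beta_trunc \<beta> N x \<le> x" using r assms by (simp add: beta_trunc_def)
  have "(beta_map \<beta> ^^ N) x / \<beta> ^ N < 1 / \<beta> ^ N" using r assms by (intro divide_strict_right_mono) auto
  then show "x - 1 / \<beta> ^ N < beta_trunc \<beta> N x" by (simp add: beta_trunc_def)
qed

text \<open>Differences of two sums have digits up to 2D, so Garsia's lemma separates the sums
  themselves; separation bounds their number in an interval by a multiple of \<beta>^N.\<close>

lemma pisot_beta_sums_count:
  assumes "pisot \<beta>"
  obtains c C where "c > 0" "C \<ge> 1"
    "\<And>N x y. x \<in> beta_sums \<beta> N D \<Longrightarrow> y \<in> beta_sums \<beta> N D \<Longrightarrow> x \<noteq> y \<Longrightarrow> \<bar>x - y\<bar> \<ge> c / \<beta> ^ N"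
    "\<And>N S. S \<subseteq> beta_sums \<beta> N D \<Longrightarrow> S \<subseteq> {0..l} \<Longrightarrow> finite S \<and> real (card S) \<le> C * \<beta> ^ N"
proof -
  have b1: "\<beta> > 1" using assms by (simp add: pisot_def)
  obtain c where c: "c > 0" "\<And>N x. x \<in> beta_sums \<beta> N (D + D) \<Longrightarrow> x \<noteq> 0 \<Longrightarrow> \<bar>x\<bar> \<ge> c / \<beta> ^ N"
    using pisot_separation[OF assms] by blast
  have sep: "\<bar>x - y\<bar> \<ge> c / \<beta> ^ N" if "x \<in> beta_sums \<beta> N D" "y \<in> beta_sums \<beta> N D" "x \<noteq> y" for N x y
    using c(2)[of "x - y" N] beta_sums_plus[OF that(1) beta_sums_minus[OF that(2)]] that(3) by simp
  show ?thesis
  proof (rule that[of c "\<bar>l\<bar> / c + 1"])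
    fix N S assume S: "S \<subseteq> beta_sums \<beta> N D" "S \<subseteq> {0..l}"
    have pos: "c / \<beta> ^ N > 0" using c(1) b1 by simp
    have s: "\<bar>x - y\<bar> \<ge> c / \<beta> ^ N" if "x \<in> S" "y \<in> S" "x \<noteq> y" for x y
      using sep S that by blast
    have S': "S \<subseteq> {0..\<bar>l\<bar>}" using S(2) by force
    note * = separated_card_le[OF S' pos s, simplified]
    have "1 \<le> \<beta> ^ N" using b1 by simp
    then have "\<bar>l\<bar> / (c / \<beta> ^ N) + 1 \<le> (\<bar>l\<bar> / c + 1) * \<beta> ^ N" by (simp add: algebra_simps)
    then show "finite S \<and> real (card S) \<le> (\<bar>l\<bar> / c + 1) * \<beta> ^ N" using * by (auto intro: order_trans)
  next
    show "1 \<le> \<bar>l\<bar> / c + 1" using c(1) by simp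
  qed (fact c(1), fact sep)
qed

section \<open>Invariant measures\<close>

locale pisot_invariant_measure = prob_space \<nu> for \<nu> :: "real measure" +
  fixes \<beta> :: real
  assumes pisot: "pisot \<beta>"
    and sets_eq [measurable_cong, simp]: "sets \<nu> = sets borel"
    and invariant: "A \<in> sets borel \<Longrightarrow> emeasure \<nu> (beta_map \<beta> -` A) = emeasure \<nu> A"
begin

abbreviation T :: "nat \<Rightarrow> real \<Rightarrow> real" where "T N \<equiv> beta_map \<beta> ^^ N"

lemma space_eq [simp]: "space \<nu> = UNIV"
  using sets_eq_imp_space_eq[OF sets_eq] by simp

lemma \<beta>_gt_1: "\<beta> > 1" using pisot by (simp add: pisot_def)

text \<open>Fractional parts lie in [0,1), so the preimage of this interval is the whole line and
  invariance gives it full mass.\<close>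

lemma unit_half_open: "emeasure \<nu> {0..<1} = 1"
proof -
  have "beta_map \<beta> -` {0..<1} = UNIV" using beta_map_range by auto
  then show ?thesis using invariant[of "{0..<1}"] emeasure_space_1 by simp
qed

lemma AE_unit: "AE x in \<nu>. x \<in> {0..<1}"
proof (rule AE_prob_1)
  show "prob {0..<1} = 1" using unit_half_open by (simp add: measure_def)
qed

lemma distr_T: "distr \<nu> borel (T N) = \<nu>"
proof (induction N)
  case 0
  show ?case by (rule measure_eqI) (auto simp: emeasure_distr)
next
  case (Suc N)
  have 1: "distr \<nu> borel (beta_map \<beta>) = \<nu>"
    by (rule measure_eqI) (auto simp: emeasure_distr invariant)
  have "distr \<nu> borel (T (Suc N)) = distr \<nu> borel (beta_map \<beta> \<circ> T N)" by simp
  also have "\<dots> = distr (distr \<nu> borel (T N)) borel (beta_map \<beta>)"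
    by (subst distr_distr) auto
  finally show ?case by (simp only: Suc 1)
qed

lemma prob_T_vimage: "A \<in> sets borel \<Longrightarrow> prob (T N -` A) = prob A"
  using measure_distr[of "T N" \<nu> borel A] by (simp add: distr_T)

lemma integral_T:
  assumes "f \<in> borel_measurable borel"
  shows "(\<integral>x. f (T N x) \<partial>\<nu>) = (\<integral>x. f x \<partial>\<nu> :: real)"
  using integral_distr[of "T N" \<nu> borel f] assms by (simp add: distr_T)

text \<open>If \<open>\<nu>\<close> charges a Lebesgue-null set, then the truncations of a compact subset \<open>K\<close> of it are
  few by separation, and a code spending half of its weight on them beats the uniform code.\<close>

lemma economical_code:
  assumes A: "A \<in> sets borel" "emeasure \<nu> A > 0" "emeasure lborel A = 0"
  obtains M r where "M \<ge> 1" "r \<in> borel_measurable borel" "\<And>v. 0 < r v" "\<And>v. r v \<le> 1"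
    "finite (beta_trunc \<beta> M ` {0..<1})" "(\<Sum>v\<in>beta_trunc \<beta> M ` {0..<1}. r v) \<le> 1"
    "integrable \<nu> (\<lambda>x. - ln (r (beta_trunc \<beta> M x)))"
    "(\<integral>x. - ln (r (beta_trunc \<beta> M x)) \<partial>\<nu>) < M * ln \<beta>"
proof -
  have "emeasure \<nu> (A \<inter> {0..<1}) = emeasure \<nu> A"
    by (rule emeasure_eq_AE) (use AE_unit A in auto)
  then have "0 < (SUP K \<in> {K. K \<subseteq> A \<inter> {0..<1} \<and> compact K}. emeasure \<nu> K)"
    using inner_regular[OF sets_eq, of "A \<inter> {0..<1}"] A by simp
  then obtain K where K: "K \<subseteq> A" "K \<subseteq> {0..<1}" "compact K" "emeasure \<nu> K > 0"
    unfolding less_SUP_iff by auto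
  have Kb: "K \<in> sets borel" using K(3) by (simp add: borel_compact)
  define p where "p = prob K"
  have p: "p > 0" "p \<le> 1" using K(4) by (auto simp: p_def emeasure_eq_measure)
  obtain c C where c: "c > 0" and C: "C \<ge> 1"
    and sep: "\<And>N x y. x \<in> beta_sums \<beta> N \<lceil>\<beta>\<rceil> \<Longrightarrow> y \<in> beta_sums \<beta> N \<lceil>\<beta>\<rceil> \<Longrightarrow> x \<noteq> y \<Longrightarrow> \<bar>x - y\<bar> \<ge> c / \<beta> ^ N"
    and count: "\<And>N S. S \<subseteq> beta_sums \<beta> N \<lceil>\<beta>\<rceil> \<Longrightarrow> S \<subseteq> {0..1} \<Longrightarrow> finite S \<and> real (card S) \<le> C * \<beta> ^ N"
    using pisot_beta_sums_count[OF pisot, of "\<lceil>\<beta>\<rceil>" 1] by metis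
  \<comment> \<open>Chosen so that p ln(2\<epsilon>) = -ln(2C) - 1: the saving on \<open>K\<close>
    outweighs by 1 the overhead ln(2C) of the code elsewhere.\<close>
  define \<epsilon> where "\<epsilon> = exp (- (ln (2 * C) + 1) / p) / 2"
  have eps: "\<epsilon> > 0" by (simp add: \<epsilon>_def)
  have lneps: "p * ln (2 * \<epsilon>) = - ln (2 * C) - 1" using p by (simp add: \<epsilon>_def)
  have lnC: "ln (2 * C) > 0" using C by (intro ln_gt_zero) simp
  have "emeasure lborel K \<le> 0" using A(3) emeasure_mono[of K A lborel] K(1) A(1) by simp
  then have K0: "emeasure lborel K = 0" by simp
  have "c * \<epsilon> > 0" using c eps by simp
  then obtain U where U: "open U" "K \<subseteq> U" "emeasure lborel (U - K) < ennreal (c * \<epsilon>)"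
    using outer_regular_lborel[OF Kb] by metis
  have "emeasure lborel U \<le> emeasure lborel (U - K) + emeasure lborel K"
    using emeasure_subadditive[of "U - K" lborel K] U(1,2) Kb by (simp add: Un_absorb2)
  then have U3: "emeasure lborel U < ennreal (c * \<epsilon>)" using U(3) K0 by simp
  obtain d where d: "d > 0" "(\<Union>x\<in>K. ball x d) \<subseteq> U"
    using compact_subset_open_imp_ball_epsilon_subset[OF K(3) U(1,2)] by blast
  \<comment> \<open>Makes the intervals of length c/\<beta>^M that start at truncations of points of
    \<open>K\<close> stay within distance d of \<open>K\<close>, hence inside
    \<open>U\<close>.\<close>
  obtain M where M: "M \<ge> 1" "(1 + c) / \<beta> ^ M < d"
  proof -
    obtain M0 where M0: "\<beta> ^ M0 > (1 + c) / d" using real_arch_pow[OF \<beta>_gt_1] by blast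
    also have "\<beta> ^ M0 \<le> \<beta> ^ Suc M0" using \<beta>_gt_1 by (intro power_increasing) auto
    finally have "(1 + c) / \<beta> ^ Suc M0 < d" using d(1) \<beta>_gt_1 by (simp add: field_simps)
    then show ?thesis using that[of "Suc M0"] by simp
  qed
  define L where "L = beta_trunc \<beta> M"
  define S where "S = L ` {0..<1}"
  define V where "V = L ` K"
  have S_sums: "S \<subseteq> beta_sums \<beta> M \<lceil>\<beta>\<rceil>"
    unfolding S_def L_def using beta_trunc_in_beta_sums[OF \<beta>_gt_1] by auto
  have S_unit: "S \<subseteq> {0..1}"
  proof
    fix v assume "v \<in> S"
    then obtain x where x: "0 \<le> x" "x < 1" and v: "v = beta_trunc \<beta> M x" by (auto simp: S_def L_def)
    show "v \<in> {0..1}"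
      unfolding v using beta_trunc_in_beta_sums[OF \<beta>_gt_1 x, of M] beta_trunc_bounds(1)[OF \<beta>_gt_1 x, of M] x
      by simp
  qed
  have S: "finite S" "real (card S) \<le> C * \<beta> ^ M" using count[OF S_sums S_unit] by auto
  have VS: "V \<subseteq> S" using K(2) by (auto simp: V_def S_def)
  have Vfin: "finite V" using VS S finite_subset by blast
  have "K \<noteq> {}" using K(4) by auto
  then have "V \<noteq> {}" by (auto simp: V_def)
  define k where "k = real (card V)"
  define s where "s = real (card S)"
  have k: "k \<ge> 1" using Vfin \<open>V \<noteq> {}\<close> by (simp add: k_def card_gt_0_iff Suc_le_eq)
  have s: "s \<ge> 1" using S VS \<open>V \<noteq> {}\<close> by (simp add: s_def card_gt_0_iff Suc_le_eq) blast
  define h where "h = c / \<beta> ^ M"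
  have h: "h > 0" using c \<beta>_gt_1 by (simp add: h_def)
  have kle: "k \<le> \<epsilon> * \<beta> ^ M"
  proof -
    \<comment> \<open>Separation makes these intervals disjoint, so their total length
      \<open>k * h\<close> is below the measure of \<open>U\<close>.\<close>
    have disj: "disjoint_family_on (\<lambda>v. {v..<v+h}) V"
      unfolding disjoint_family_on_def
    proof (intro ballI impI)
      fix v w assume "v \<in> V" "w \<in> V" "v \<noteq> w"
      then have "\<bar>v - w\<bar> \<ge> h" using sep[of v M w] VS S_sums by (auto simp: h_def)
      then show "{v..<v+h} \<inter> {w..<w+h} = {}" by auto
    qed
    have sub: "(\<Union>v\<in>V. {v..<v+h}) \<subseteq> U"
    proof
      fix y assume "y \<in> (\<Union>v\<in>V. {v..<v+h})"
      then obtain x where x: "x \<in> K" "L x \<le> y" "y < L x + h" by (auto simp: V_def)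
      have "L x \<le> x" "x - 1 / \<beta> ^ M < L x"
        using beta_trunc_bounds[OF \<beta>_gt_1, of x M] x(1) K(2) by (auto simp: L_def)
      moreover have "(1 + c) / \<beta> ^ M = 1 / \<beta> ^ M + h" by (simp add: h_def add_divide_distrib)
      moreover have "1 / \<beta> ^ M > 0" using \<beta>_gt_1 by simp
      ultimately have "\<bar>x - y\<bar> < (1 + c) / \<beta> ^ M" using x(2,3) h by linarith
      then have "y \<in> ball x d" using M(2) by (simp add: dist_real_def)
      then show "y \<in> U" using d(2) x(1) by blast
    qed
    have "(\<Sum>v\<in>V. emeasure lborel {v..<v+h}) = emeasure lborel (\<Union>v\<in>V. {v..<v+h})"
      using disj Vfin by (intro sum_emeasure) auto
    also have "\<dots> \<le> emeasure lborel U" using sub U(1) by (intro emeasure_mono) auto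
    also have "\<dots> < ennreal (c * \<epsilon>)" by fact
    finally have "ennreal (k * h) < ennreal (c * \<epsilon>)"
      using h by (simp add: k_def ennreal_mult ennreal_of_nat_eq_real_of_nat)
    then have "k * h < c * \<epsilon>" using h k by (simp add: ennreal_less_iff)
    then show ?thesis using c \<beta>_gt_1 by (simp add: h_def field_simps)
  qed
  \<comment> \<open>Half of the weight is uniform on \<open>V\<close> and the other half is spread
    over \<open>S\<close>; -ln r is the code length. The value off \<open>V\<close> also keeps r
    positive outside \<open>S\<close>.\<close>
  define r where "r = (\<lambda>v. if v \<in> V then 1 / (2 * k) else 1 / (2 * s))"
  have Vb: "V \<in> sets borel" using Vfin by (simp add: finite_imp_closed)
  have r_meas: "r \<in> borel_measurable borel" unfolding r_def using Vb by measurable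
  have r_pos: "0 < r v" "r v \<le> 1" for v using k s by (auto simp: r_def divide_simps)
  have r_sum: "(\<Sum>v\<in>S. r v) \<le> 1"
  proof -
    have "(\<Sum>v\<in>S. r v) = (\<Sum>v\<in>V. r v) + (\<Sum>v\<in>S - V. r v)"
      using S(1) VS by (metis add.commute sum.subset_diff)
    also have "(\<Sum>v\<in>V. r v) = 1 / 2" using k by (simp add: r_def k_def[symmetric])
    also have "(\<Sum>v\<in>S - V. r v) = (\<Sum>v\<in>S - V. 1 / (2 * s))"
      by (rule sum.cong) (auto simp: r_def)
    also have "\<dots> \<le> (\<Sum>v\<in>S. 1 / (2 * s))"
      using S(1) s by (intro sum_mono2) auto
    also have "\<dots> = 1 / 2" using s by (simp add: s_def[symmetric])
    finally show ?thesis by simp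
  qed
  define g where "g = (\<lambda>x. - ln (r (L x)))"
  define W where "W = L -` V"
  have Lm [measurable]: "L \<in> borel_measurable borel" by (simp add: L_def)
  have Wb: "W \<in> sets borel" unfolding W_def using measurable_sets[OF Lm Vb] by simp
  have g: "g = (\<lambda>x. ln (2 * s) + (ln (2 * k) - ln (2 * s)) * indicator W x)"
    using k s by (auto simp: g_def r_def W_def ln_div indicator_def)
  have Wi: "integrable \<nu> (indicator W :: real \<Rightarrow> real)"
    using Wb by (intro integrable_real_indicator) (auto simp: emeasure_eq_measure)
  then have Wi': "integrable \<nu> (\<lambda>x. (ln (2 * k) - ln (2 * s)) * indicator W x)"
    by (intro Bochner_Integration.integrable_mult_right)
  have gint: "integrable \<nu> g" unfolding g
    using Wi' by (intro Bochner_Integration.integrable_add) simp_all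
  have "(\<integral>x. g x \<partial>\<nu>) = ln (2 * s) + (ln (2 * k) - ln (2 * s)) * prob W"
    unfolding g using Wi' Bochner_Integration.integral_add[OF integrable_const Wi', of "ln (2 * s)"] prob_space
    by simp
  also have "\<dots> = (1 - prob W) * ln (2 * s) + prob W * ln (2 * k)" by (simp add: algebra_simps)
  also have "\<dots> \<le> (1 - prob W) * (ln (2 * C) + M * ln \<beta>) + prob W * (ln (2 * \<epsilon>) + M * ln \<beta>)"
  proof (intro add_mono mult_left_mono)
    have "ln (2 * s) \<le> ln (2 * C * \<beta> ^ M)" using S(2) s C by (intro ln_mono) (auto simp: s_def)
    also have "\<dots> = ln (2 * C) + M * ln \<beta>" using C \<beta>_gt_1 by (simp add: ln_mult ln_realpow)
    finally show "ln (2 * s) \<le> ln (2 * C) + M * ln \<beta>" .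
    have "ln (2 * k) \<le> ln (2 * \<epsilon> * \<beta> ^ M)" using kle k by (intro ln_mono) auto
    also have "\<dots> = ln (2 * \<epsilon>) + M * ln \<beta>" using eps \<beta>_gt_1 by (simp add: ln_mult ln_realpow)
    finally show "ln (2 * k) \<le> ln (2 * \<epsilon>) + M * ln \<beta>" .
  qed (auto simp: measure_le_1)
  also have "\<dots> = M * ln \<beta> + (1 - prob W) * ln (2 * C) + prob W * ln (2 * \<epsilon>)" by (simp add: algebra_simps)
  also have "\<dots> \<le> M * ln \<beta> + 1 * ln (2 * C) + p * ln (2 * \<epsilon>)"
  proof -
    have "K \<subseteq> W" by (auto simp: W_def V_def)
    then have "p \<le> prob W" unfolding p_def using Wb by (intro finite_measure_mono) auto
    moreover have "ln (2 * \<epsilon>) \<le> 0"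
    proof -
      have "p * ln (2 * \<epsilon>) < 0" using lneps lnC by simp
      then show ?thesis using p by (simp add: mult_less_0_iff)
    qed
    ultimately have "prob W * ln (2 * \<epsilon>) \<le> p * ln (2 * \<epsilon>)" by (rule mult_right_mono_neg)
    moreover have "(1 - prob W) * ln (2 * C) \<le> 1 * ln (2 * C)" using lnC by (intro mult_right_mono) auto
    ultimately show ?thesis by linarith
  qed
  also have "\<dots> < M * ln \<beta>" using lneps by simp
  finally have gl: "(\<integral>x. g x \<partial>\<nu>) < M * ln \<beta>" .
  show thesis
    by (rule that[of M r]) (use M(1) r_meas r_pos S(1) r_sum gint gl in \<open>auto simp: g_def S_def L_def\<close>)
qed

text \<open>Coding \<open>j\<close> consecutive blocks of length \<open>M\<close> has expected
  length j\<gamma> by invariance. By Markov's inequality the length stays below j a with probability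
  at least 1 - \<gamma>/a, and Kraft's inequality leaves at most exp(j a) words that short.\<close>

lemma few_truncations:
  assumes "measure_dim \<nu> < 1"
  obtains M s p where "M \<ge> 1" "0 < s" "s < 1" "p > 0"
    "\<And>j. j \<ge> 1 \<Longrightarrow> \<exists>E. E \<in> sets borel \<and> E \<subseteq> {0..<1} \<and> prob E \<ge> p \<and>
      finite (beta_trunc \<beta> (j * M) ` E) \<and> real (card (beta_trunc \<beta> (j * M) ` E)) \<le> \<beta> powr (s * real (j * M))"
proof -
  obtain A where A: "A \<in> sets borel" "emeasure \<nu> A > 0" "hausdorff_dim A < 1"
    using measure_dim_less[OF prob_space_axioms sets_eq assms] by blast
  obtain M r where M: "M \<ge> 1" and r_meas [measurable]: "r \<in> borel_measurable borel" and r: "\<And>v. 0 < r v" "\<And>v. r v \<le> 1"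
    and fin: "finite (beta_trunc \<beta> M ` {0..<1})" and r_sum: "(\<Sum>v\<in>beta_trunc \<beta> M ` {0..<1}. r v) \<le> 1"
    and int: "integrable \<nu> (\<lambda>x. - ln (r (beta_trunc \<beta> M x)))"
    and less: "(\<integral>x. - ln (r (beta_trunc \<beta> M x)) \<partial>\<nu>) < M * ln \<beta>"
    using economical_code[OF A(1,2) hausdorff_dim_less_1_imp_lebesgue_null[OF A(1,3)]] by blast
  define L where "L = beta_trunc \<beta> M"
  define S where "S = L ` {0..<1}"
  define g where "g = (\<lambda>x. - ln (r (L x)))"
  have g_meas [measurable]: "g \<in> borel_measurable borel" unfolding g_def L_def by measurable
  have g_nonneg: "g x \<ge> 0" for x using r[of "L x"] by (simp add: g_def)
  define \<gamma> where "\<gamma> = (\<integral>x. g x \<partial>\<nu>)"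
  define G where "G = M * ln \<beta>"
  have \<gamma>: "0 \<le> \<gamma>" "\<gamma> < G"
    unfolding \<gamma>_def using g_nonneg by (rule Bochner_Integration.integral_nonneg)
      (use less in \<open>simp add: G_def g_def L_def\<close>)
  \<comment> \<open>Any value strictly between the mean code length and M ln \<beta> works: a >
    \<gamma> makes the probability positive, a < G makes s = a/G less than 1.\<close>
  define a where "a = (\<gamma> + G) / 2"
  have a: "\<gamma> < a" "a < G" "0 < a" using \<gamma> by (auto simp: a_def)
  show thesis
  proof (rule that[of M "a / G" "1 - \<gamma> / a"])
    fix j :: nat assume j: "j \<ge> 1"
    define I where "I = (\<lambda>x. \<Sum>i<j. g (T (i * M) x))"
    define E where "E = {x \<in> {0..<1}. I x < j * a}"
    have gT: "integrable \<nu> (\<lambda>x. g (T N x))" for N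
      using integrable_distr[of "T N" \<nu> borel g] int by (simp add: distr_T g_def L_def)
    have I_int: "integrable \<nu> I" unfolding I_def using gT by (intro Bochner_Integration.integrable_sum) auto
    have I_val: "(\<integral>x. I x \<partial>\<nu>) = j * \<gamma>"
      unfolding I_def using gT by (simp add: integral_T \<gamma>_def)
    have I_nonneg: "I x \<ge> 0" for x unfolding I_def using g_nonneg by (intro sum_nonneg) auto
    have I_meas [measurable]: "I \<in> borel_measurable borel" unfolding I_def by measurable
    have Eb: "E \<in> sets borel" unfolding E_def by measurable
    have "prob {x \<in> space \<nu>. j * a \<le> I x} \<le> (\<integral>x. I x \<partial>\<nu>) / (j * a)"
      using I_int I_nonneg a j by (intro integral_Markov_inequality_measure[where A = UNIV]) auto
    also have "\<dots> = \<gamma> / a" using j by (simp add: I_val)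
    finally have bad: "prob {x. j * a \<le> I x} \<le> \<gamma> / a" by simp
    have "1 = prob (E \<union> {x. j * a \<le> I x})"
    proof -
      have "AE x in \<nu>. x \<in> E \<union> {x. j * a \<le> I x}" using AE_unit by eventually_elim (auto simp: E_def)
      moreover have "E \<union> {x. j * a \<le> I x} \<in> sets \<nu>" using Eb by simp
      ultimately show ?thesis using prob_eq_1 by metis
    qed
    also have "\<dots> \<le> prob E + prob {x. j * a \<le> I x}"
      using Eb by (intro measure_Un_le) auto
    finally have pE: "prob E \<ge> 1 - \<gamma> / a" using bad by simp
    define Wd where "Wd = {w \<in> {..<j} \<rightarrow>\<^sub>E S. (\<Prod>i<j. r (w i)) \<ge> exp (- (j * a))}"
    have PiE_fin: "finite ({..<j} \<rightarrow>\<^sub>E S)"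
      using fin by (intro finite_PiE) (simp_all add: S_def L_def)
    then have Wfin: "finite Wd" unfolding Wd_def by simp
    \<comment> \<open>Kraft's inequality: the product weights of all words sum to at most 1, and
      each word of \<open>Wd\<close> has weight at least exp(-j a).\<close>
    have Wcard: "real (card Wd) \<le> exp (j * a)"
    proof -
      have "real (card Wd) * exp (- (j * a)) = (\<Sum>w\<in>Wd. exp (- (j * a)))" by simp
      also have "\<dots> \<le> (\<Sum>w\<in>Wd. \<Prod>i<j. r (w i))" by (rule sum_mono) (simp add: Wd_def)
      also have "\<dots> \<le> (\<Sum>w\<in>{..<j} \<rightarrow>\<^sub>E S. \<Prod>i<j. r (w i))"
        using PiE_fin r(1) by (intro sum_mono2) (simp_all add: Wd_def prod_nonneg less_imp_le)
      also have "\<dots> = (\<Prod>i<j. \<Sum>v\<in>S. r v)"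
        using fin by (intro prod_sum_PiE[symmetric]) (auto simp: S_def L_def)
      also have "\<dots> \<le> 1"
        using r_sum r(1) by (intro prod_le_1) (simp add: S_def L_def sum_nonneg less_imp_le)
      finally show ?thesis by (simp add: exp_minus field_simps)
    qed
    \<comment> \<open>Reassembles a long truncation from its blocks, so there are no more
      truncations than words.\<close>
    define F where "F = (\<lambda>w :: nat \<Rightarrow> real. \<Sum>i<j. w i / \<beta> ^ (i * M))"
    have "beta_trunc \<beta> (j * M) ` E \<subseteq> F ` Wd"
    proof
      fix v assume "v \<in> beta_trunc \<beta> (j * M) ` E"
      then obtain x where x: "x \<in> E" and v: "v = beta_trunc \<beta> (j * M) x" by blast
      define w where "w = (\<lambda>i\<in>{..<j}. L (T (i * M) x))"
      have x01: "0 \<le> x" "x < 1" using x by (auto simp: E_def)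
      have "beta_trunc \<beta> (n * M) x = (\<Sum>i<n. L (T (i * M) x) / \<beta> ^ (i * M))" for n
      proof (induction n)
        case 0
        then show ?case by (simp add: beta_trunc_def)
      next
        case (Suc n)
        then show ?case using beta_trunc_add[of \<beta> "n * M" M x] by (simp add: L_def add.commute)
      qed
      then have "v = F w" by (simp add: v F_def w_def)
      moreover have "w \<in> Wd"
      proof -
        have "w \<in> {..<j} \<rightarrow>\<^sub>E S" using funpow_beta_map_range[OF x01] by (auto simp: w_def S_def)
        moreover have "(\<Prod>i<j. r (w i)) = exp (- I x)"
          using r(1) by (simp add: I_def g_def w_def sum_negf exp_sum)
        moreover have "exp (- I x) \<ge> exp (- (j * a))" using x by (simp add: E_def)
        ultimately show ?thesis by (simp add: Wd_def)
      qed
      ultimately show "v \<in> F ` Wd" by blast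
    qed
    then have sub: "finite (beta_trunc \<beta> (j * M) ` E)" "card (beta_trunc \<beta> (j * M) ` E) \<le> card Wd"
      using Wfin surj_card_le by (auto intro: finite_surj)
    have "\<beta> powr (a / G * real (j * M)) = exp (j * a)"
    proof -
      have "\<beta> powr (a / G * real (j * M)) = exp (a / G * real (j * M) * ln \<beta>)" using \<beta>_gt_1 by (simp add: powr_def)
      also have "a / G * real (j * M) * ln \<beta> = j * a * (G / G)" by (simp add: G_def)
      finally show ?thesis using a by simp
    qed
    then show "\<exists>E. E \<in> sets borel \<and> E \<subseteq> {0..<1} \<and> prob E \<ge> 1 - \<gamma> / a \<and>
      finite (beta_trunc \<beta> (j * M) ` E) \<and> real (card (beta_trunc \<beta> (j * M) ` E)) \<le> \<beta> powr (a / G * real (j * M))"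
      using Eb pE sub Wcard by (intro exI[of _ E]) (auto simp: E_def intro: order_trans[OF _ Wcard])
  qed (use M a in auto)
qed

end

section \<open>Digit measures with windows\<close>

text \<open>Digit sets may vary with the position. Separation 3/B dominates the later digits, which
  after position j contribute at most 2/B^(j+1). Position 0 is not scaled, so expansions range over
  [0,2].\<close>

locale digit_measure =
  fixes B :: real and Dg :: "nat \<Rightarrow> real set"
  assumes B_ge_2: "B \<ge> 2"
    and digits: "finite (Dg j)" "Dg j \<noteq> {}" "Dg j \<subseteq> {0..<1}"
    and separated: "x \<in> Dg j \<Longrightarrow> y \<in> Dg j \<Longrightarrow> x \<noteq> y \<Longrightarrow> \<bar>x - y\<bar> \<ge> 3 / B"
begin

definition digit_space :: "(nat \<Rightarrow> real) measure" where
  "digit_space = PiM UNIV (\<lambda>j. uniform_count_measure (Dg j))"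

definition expansion :: "(nat \<Rightarrow> real) \<Rightarrow> real" where
  "expansion w = (\<Sum>j. w j / B ^ j)"

definition digit_distr :: "real measure" where
  "digit_distr = distr digit_space borel expansion"

sublocale product_prob_space "\<lambda>j. uniform_count_measure (Dg j)" UNIV
  by (rule product_prob_spaceI) (rule prob_space_uniform_count_measure[OF digits(1,2)])

lemma space_digit_space: "w \<in> space digit_space \<longleftrightarrow> (\<forall>j. w j \<in> Dg j)"
  by (simp add: digit_space_def space_PiM PiE_iff space_uniform_count_measure)

lemma digit_01:
  assumes "w \<in> space digit_space"
  shows "0 \<le> w j" "w j < 1"
  using assms digits(3)[of j] by (auto simp: space_digit_space)

lemma summable_geom: "summable (\<lambda>j. 1 / B ^ j)"
  using B_ge_2 summable_geometric[of "1 / B"] by (simp add: power_one_over)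

lemma suminf_geom_le: "(\<Sum>j. 1 / B ^ (j + n)) \<le> 2 / B ^ n"
proof -
  have "(\<Sum>j. 1 / B ^ (j + n)) = (\<Sum>j. 1 / B ^ n * (1 / B) ^ j)"
    by (simp add: power_add power_one_over mult.commute)
  also have "\<dots> = 1 / B ^ n * (1 / (1 - 1 / B))"
    using B_ge_2 by (subst suminf_mult) (auto simp: suminf_geometric summable_geometric)
  also have "1 / (1 - 1 / B) \<le> 2" using B_ge_2 by (simp add: field_simps)
  finally show ?thesis using B_ge_2 by (simp add: mult_left_mono divide_right_mono)
qed

lemma summable_digits:
  assumes "\<And>j. \<bar>u j\<bar> \<le> 1"
  shows "summable (\<lambda>j. u j / B ^ j)"
proof (rule summable_comparison_test[OF _ summable_geom])
  show "\<exists>N. \<forall>n\<ge>N. norm (u n / B ^ n) \<le> 1 / B ^ n"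
    using assms B_ge_2 by (auto simp: abs_divide intro!: divide_right_mono)
qed

lemma tail_bound:
  assumes "\<And>j. \<bar>u j\<bar> \<le> 1"
  shows "\<bar>\<Sum>j. u (j + n) / B ^ (j + n)\<bar> \<le> 2 / B ^ n"
proof -
  have s: "summable (\<lambda>j. 1 / B ^ (j + n))" using summable_geom by (rule summable_ignore_initial_segment)
  have "\<bar>\<Sum>j. u (j + n) / B ^ (j + n)\<bar> \<le> (\<Sum>j. 1 / B ^ (j + n))"
    unfolding real_norm_def[symmetric] using assms B_ge_2
    by (intro norm_suminf_le[OF _ s]) (auto simp: abs_divide intro!: divide_right_mono)
  then show ?thesis using suminf_geom_le[of n] by linarith
qed

lemma expansion_split:
  assumes "w \<in> space digit_space"
  shows "\<exists>t. 0 \<le> t \<and> t \<le> 2 / B ^ n \<and> expansion w = (\<Sum>j<n. w j / B ^ j) + t"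
proof -
  have u: "\<bar>w j\<bar> \<le> 1" for j using digit_01[OF assms, of j] by simp
  have "expansion w = (\<Sum>j. w (j + n) / B ^ (j + n)) + (\<Sum>j<n. w j / B ^ j)"
    unfolding expansion_def using summable_digits[OF u] by (rule suminf_split_initial_segment)
  moreover have "(\<Sum>j. w (j + n) / B ^ (j + n)) \<ge> 0"
    using digit_01[OF assms] B_ge_2 summable_ignore_initial_segment[OF summable_digits[of w, OF u], of n]
    by (intro suminf_nonneg) auto
  ultimately show ?thesis using tail_bound[of w n, OF u] by (intro exI[of _ "\<Sum>j. w (j + n) / B ^ (j + n)"]) auto
qed

text \<open>At the first differing position j the digits contribute at least 3/B^(j+1) and the tails
  cancel at most 2/B^(j+1), leaving a gap of at least 1/B^J.\<close>

lemma expansion_close_imp_same_prefix: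
  assumes w: "w \<in> space digit_space" "w' \<in> space digit_space"
    and close: "\<bar>expansion w - expansion w'\<bar> < 1 / B ^ J" and "j < J"
  shows "w j = w' j"
  using \<open>j < J\<close>
proof (induction j rule: less_induct)
  case (less j)
  show ?case
  proof (rule ccontr)
    assume ne: "w j \<noteq> w' j"
    define u where "u = (\<lambda>i. w i - w' i)"
    have u: "\<bar>u i\<bar> \<le> 1" for i
      using digit_01[OF w(1), of i] digit_01[OF w(2), of i] by (simp add: u_def abs_le_iff)
    have sw: "summable (\<lambda>j. w j / B ^ j)" "summable (\<lambda>j. w' j / B ^ j)"
      using digit_01[OF w(1)] digit_01[OF w(2)] by (intro summable_digits; simp add: less_imp_le)+
    have "expansion w - expansion w' = (\<Sum>i. u i / B ^ i)"
      unfolding expansion_def u_def using suminf_diff[OF sw] by (simp add: diff_divide_distrib)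
    also have "\<dots> = (\<Sum>i. u (i + Suc j) / B ^ (i + Suc j)) + (\<Sum>i<Suc j. u i / B ^ i)"
      using summable_digits[OF u] by (rule suminf_split_initial_segment)
    also have "(\<Sum>i<Suc j. u i / B ^ i) = u j / B ^ j"
      using less by (simp add: u_def)
    finally have "\<bar>u j / B ^ j\<bar> \<le> \<bar>expansion w - expansion w'\<bar> + 2 / B ^ Suc j"
      using tail_bound[of u "Suc j", OF u] by linarith
    moreover have "\<bar>u j / B ^ j\<bar> \<ge> 3 / B ^ Suc j"
    proof -
      have "\<bar>u j\<bar> \<ge> 3 / B" using separated[of "w j" j "w' j"] w ne by (auto simp: u_def space_digit_space)
      then have "3 / B / B ^ j \<le> \<bar>u j\<bar> / B ^ j" using B_ge_2 by (intro divide_right_mono) auto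
      then show ?thesis using B_ge_2 by (simp add: abs_divide)
    qed
    moreover have "1 / B ^ J \<le> 1 / B ^ Suc j"
      using less.prems B_ge_2 by (intro divide_left_mono power_increasing) auto
    ultimately show False using close by (simp add: field_simps)
  qed
qed

lemma component_measurable: "(\<lambda>w. w j) \<in> borel_measurable digit_space"
proof -
  have "(\<lambda>w. w j) \<in> digit_space \<rightarrow>\<^sub>M uniform_count_measure (Dg j)"
    unfolding digit_space_def by (rule measurable_component_singleton) simp
  moreover have "(\<lambda>x. x) \<in> borel_measurable (uniform_count_measure (Dg j))"
    by (auto simp: measurable_def sets_uniform_count_measure space_uniform_count_measure)
  ultimately show ?thesis by (rule measurable_compose)
qed

lemma expansion_measurable [measurable]: "expansion \<in> borel_measurable digit_space"
  unfolding expansion_def[abs_def] using component_measurable by measurable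

lemma prob_space_digit_distr: "prob_space digit_distr"
  unfolding digit_distr_def
  by (rule prob_space.prob_space_distr[OF _ expansion_measurable]) (simp add: digit_space_def P.prob_space_axioms)

lemma sets_digit_distr: "sets digit_distr = sets borel"
  by (simp add: digit_distr_def)

lemma digit_distr_full:
  assumes "S \<in> sets borel" "\<And>w. w \<in> space digit_space \<Longrightarrow> expansion w \<in> S"
  shows "emeasure digit_distr S = 1"
proof -
  have "expansion -` S \<inter> space digit_space = space digit_space" using assms(2) by auto
  then have "emeasure digit_distr S = emeasure digit_space (space digit_space)"
    unfolding digit_distr_def using assms(1) by (simp add: emeasure_distr)
  then show ?thesis using P.emeasure_space_1 by (simp add: digit_space_def)
qed

lemma emeasure_cylinder:
  assumes "w \<in> space digit_space"
  shows "emeasure digit_space (prod_emb UNIV (\<lambda>j. uniform_count_measure (Dg j)) {..<J} (\<Pi>\<^sub>E j\<in>{..<J}. {w j}))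
    = ennreal (1 / (\<Prod>j<J. real (card (Dg j))))"
proof -
  have "emeasure digit_space (prod_emb UNIV (\<lambda>j. uniform_count_measure (Dg j)) {..<J} (\<Pi>\<^sub>E j\<in>{..<J}. {w j}))
    = (\<Prod>j<J. emeasure (uniform_count_measure (Dg j)) {w j})"
    unfolding digit_space_def
    by (rule emeasure_PiM_emb) (use assms in \<open>auto simp: space_digit_space sets_uniform_count_measure\<close>)
  also have "\<dots> = (\<Prod>j<J. ennreal (1 / real (card (Dg j))))"
    using assms digits by (intro prod.cong refl) (subst emeasure_uniform_count_measure, auto simp: space_digit_space)
  also have "\<dots> = ennreal (\<Prod>j<J. 1 / real (card (Dg j)))"
    by (rule prod_ennreal) simp
  finally show ?thesis by (simp add: prod_dividef)
qed

text \<open>An interval shorter than 1/B^J meets the expansions of at most one cylinder of length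
  \<open>J\<close>.\<close>

lemma digit_distr_interval_le:
  assumes "b - a < 1 / B ^ J"
  shows "emeasure digit_distr {a..b} \<le> ennreal (1 / (\<Prod>j<J. real (card (Dg j))))"
proof (cases "expansion -` {a..b} \<inter> space digit_space = {}")
  case True
  then show ?thesis unfolding digit_distr_def by (simp add: emeasure_distr)
next
  case False
  then have "\<exists>w. w \<in> space digit_space \<and> expansion w \<in> {a..b}" by blast
  then obtain w where w: "w \<in> space digit_space" "expansion w \<in> {a..b}" by blast
  let ?C = "prod_emb UNIV (\<lambda>j. uniform_count_measure (Dg j)) {..<J} (\<Pi>\<^sub>E j\<in>{..<J}. {w j})"
  have "expansion -` {a..b} \<inter> space digit_space \<subseteq> ?C"
  proof
    fix w' assume w': "w' \<in> expansion -` {a..b} \<inter> space digit_space"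
    then have "w' j = w j" if "j < J" for j
      using expansion_close_imp_same_prefix[of w' w J j] w assms that by auto
    then show "w' \<in> ?C" using w'
      by (auto simp: prod_emb_def space_digit_space space_uniform_count_measure PiE_iff)
  qed
  moreover have "?C \<in> sets digit_space" unfolding digit_space_def
    using w by (intro sets_PiM_I) (auto simp: sets_uniform_count_measure space_digit_space)
  ultimately have "emeasure digit_space (expansion -` {a..b} \<inter> space digit_space) \<le> emeasure digit_space ?C"
    by (rule emeasure_mono)
  then show ?thesis unfolding emeasure_cylinder[OF w(1)] unfolding digit_distr_def by (simp add: emeasure_distr)
qed

text \<open>Frostman estimate: an interval is compared with the first scale B^(-J) not exceeding its
  length, and passing to the preceding scale costs the factor B^t.\<close>

lemma measure_dim_digit_distr_ge:
  assumes t: "t > 0" and many: "\<And>J. (\<Prod>j<J. real (card (Dg j))) \<ge> B powr (t * real J)"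
  shows "measure_dim digit_distr \<ge> t"
proof (rule measure_dim_ge[OF prob_space_digit_distr sets_digit_distr, of "B powr t"])
  fix a b :: real assume ab: "a \<le> b" "b - a \<le> 1/2"
  have le: "emeasure digit_distr {a..b} \<le> ennreal (B powr (- t * real J))" if "b - a < 1 / B ^ J" for J
  proof -
    have "1 / (\<Prod>j<J. real (card (Dg j))) \<le> 1 / B powr (t * real J)"
      using many[of J] B_ge_2 by (intro divide_left_mono mult_pos_pos order_less_le_trans[OF _ many[of J]]) auto
    also have "\<dots> = B powr (- t * real J)" by (simp add: powr_minus_divide)
    finally show ?thesis using digit_distr_interval_le[OF that] by (meson ennreal_leI order_trans)
  qed
  have lim: "(\<lambda>J. 1 / B ^ J) \<longlonglongrightarrow> 0"
    using LIMSEQ_realpow_zero[of "1 / B"] B_ge_2 by (simp add: power_one_over)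
  show "emeasure digit_distr {a..b} \<le> ennreal (B powr t * (b - a) powr t)"
  proof (cases "a = b")
    case True
    \<comment> \<open>For a point the right-hand side is 0, so absence of atoms has to be
      shown.\<close>
    have "(\<lambda>J. ennreal ((B powr (- t)) ^ J)) \<longlonglongrightarrow> ennreal 0"
      using B_ge_2 t by (intro tendsto_ennrealI LIMSEQ_realpow_zero) (auto simp: powr_less_one)
    moreover have "emeasure digit_distr {a..b} \<le> ennreal ((B powr (- t)) ^ J)" for J
      using le[of J] True B_ge_2 by (simp add: powr_power mult.commute)
    ultimately have "emeasure digit_distr {a..b} \<le> ennreal 0"
      by (intro LIMSEQ_le_const) auto
    then show ?thesis by simp
  next
    case False
    then have pos: "b - a > 0" using ab by simp
    have "\<exists>J. 1 / B ^ J \<le> b - a"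
      using order_tendstoD(2)[OF lim pos] by (auto simp: eventually_sequentially intro: less_imp_le)
    then obtain J where J: "1 / B ^ J \<le> b - a" "\<And>i. i < J \<Longrightarrow> \<not> 1 / B ^ i \<le> b - a"
      using exists_least_iff[of "\<lambda>J. 1 / B ^ J \<le> b - a"] by blast
    have "J \<noteq> 0" using J(1) ab by (intro notI) simp
    then obtain i where i: "J = Suc i" using not0_implies_Suc by blast
    have "emeasure digit_distr {a..b} \<le> ennreal (B powr (- t * real i))" using J(2)[of i] i by (intro le) simp
    also have "B powr (- t * real i) = B powr t * (1 / B ^ J) powr t"
    proof -
      have "1 / B ^ J = B powr (- real J)" using B_ge_2 by (simp add: powr_minus_divide powr_realpow)
      then have "B powr t * (1 / B ^ J) powr t = B powr (t + - real J * t)"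
        by (simp only: powr_powr powr_add)
      also have "t + - real J * t = - t * real i" by (simp add: i algebra_simps)
      finally show ?thesis by simp
    qed
    also have "\<dots> \<le> B powr t * (b - a) powr t"
      using J(1) t B_ge_2 by (intro mult_left_mono powr_mono2) auto
    finally show ?thesis by (simp add: ennreal_leI)
  qed
qed simp

end

text \<open>Digits are frozen on the dyadically spaced windows \<open>[2\<^sup>k n, 2\<^sup>k (n + 1))\<close>, whose upper density is \<open>O(1/n)\<close>.\<close>

definition windows :: "nat \<Rightarrow> nat set" where
  "windows n = (\<Union>k. {2 ^ k * n..<2 ^ k * Suc n})"

text \<open>Only windows with index below q meet [0,J), where q is least with J \<le> 2^q n. Their
  lengths sum to 2^q - 1, and minimality of q gives 2^(q-1) n < J if q > 0.\<close>

lemma card_windows_le: "n * card ({..<J} \<inter> windows n) \<le> 2 * J"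
proof (cases "n = 0")
  case False
  have "J * 1 \<le> 2 ^ J * n" using False by (intro mult_mono less_imp_le_nat[OF less_exp]) auto
  then have "\<exists>k. J \<le> 2 ^ k * n" by auto
  then obtain q where q: "J \<le> 2 ^ q * n" "\<And>i. i < q \<Longrightarrow> \<not> J \<le> 2 ^ i * n"
    using exists_least_iff[of "\<lambda>k. J \<le> 2 ^ k * n"] by blast
  have "{..<J} \<inter> windows n \<subseteq> (\<Union>k<q. {2 ^ k * n..<2 ^ k * Suc n})"
  proof
    fix j assume "j \<in> {..<J} \<inter> windows n"
    then obtain k where k: "2 ^ k * n \<le> j" "j < 2 ^ k * Suc n" "j < J" by (auto simp: windows_def)
    have "k < q"
    proof (rule ccontr)
      assume "\<not> k < q"
      then have "2 ^ q * n \<le> 2 ^ k * n" by (intro mult_right_mono power_increasing) auto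
      then show False using k q(1) by linarith
    qed
    then show "j \<in> (\<Union>k<q. {2 ^ k * n..<2 ^ k * Suc n})" using k by auto
  qed
  then have "card ({..<J} \<inter> windows n) \<le> card (\<Union>k<q. {2 ^ k * n..<2 ^ k * Suc n})"
    by (intro card_mono) auto
  also have "\<dots> \<le> (\<Sum>k<q. card {2 ^ k * n..<2 ^ k * Suc n})" by (rule card_UN_le) simp
  also have "\<dots> = (\<Sum>k<q. 2 ^ k)" by simp
  also have "\<dots> = 2 ^ q - 1" by (induction q) auto
  finally have c: "card ({..<J} \<inter> windows n) \<le> 2 ^ q - 1" .
  show ?thesis
  proof (cases q)
    case 0
    then show ?thesis using c by simp
  next
    case (Suc i)
    have "n * card ({..<J} \<inter> windows n) \<le> n * 2 ^ q" using c by (intro mult_left_mono) auto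
    also have "\<dots> \<le> 2 * J" using q(2)[of i] Suc by (simp add: mult.commute)
    finally show ?thesis .
  qed
qed simp

section \<open>Convolutions\<close>

text \<open>The upper limit of the sets \<open>G k\<close> keeps mass at least p by continuity from
  above, while the summable contents make it null for the exponent t, as in the Borel-Cantelli
  lemma.\<close>

lemma measure_dim_le_limsup:
  fixes G :: "nat \<Rightarrow> real set"
  assumes \<theta>: "prob_space \<theta>" "sets \<theta> = sets borel"
    and G: "\<And>k. G k \<in> sets borel" and p: "p > 0" "\<And>k. measure \<theta> (G k) \<ge> p"
    and content: "\<And>k. hausdorff_content t (G k) \<le> ennreal (C * \<rho> ^ k)"
    and t: "t > 0" and C: "C \<ge> 0" and \<rho>: "0 \<le> \<rho>" "\<rho> < 1"
  shows "measure_dim \<theta> \<le> t"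
proof -
  interpret prob_space \<theta> by fact
  define H where "H = (\<lambda>n. \<Union>k. G (k + n))"
  define L where "L = (\<Inter>n. H n)"
  have Hb: "H n \<in> sets \<theta>" for n using G \<theta>(2) by (auto simp: H_def)
  have dec: "decseq H"
  proof (rule decseq_SucI)
    fix n show "H (Suc n) \<subseteq> H n"
    proof
      fix x assume "x \<in> H (Suc n)"
      then obtain k where "x \<in> G (k + Suc n)" by (auto simp: H_def)
      then show "x \<in> H n" unfolding H_def by (intro UN_I[of "Suc k"]) auto
    qed
  qed
  have "(\<lambda>n. measure \<theta> (H n)) \<longlonglongrightarrow> measure \<theta> L"
    unfolding L_def using Hb dec by (intro finite_Lim_measure_decseq) auto
  moreover have "p \<le> measure \<theta> (H n)" for n
  proof -
    have "G n \<subseteq> H n" unfolding H_def using UN_upper[of 0 UNIV "\<lambda>k. G (k + n)"] by simp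
    then have "measure \<theta> (G n) \<le> measure \<theta> (H n)" using Hb by (intro finite_measure_mono) auto
    then show ?thesis using p(2)[of n] by simp
  qed
  ultimately have "p \<le> measure \<theta> L" by (intro LIMSEQ_le_const) auto
  then have pos: "emeasure \<theta> L > 0" using p(1) by (simp add: emeasure_eq_measure)
  have Lb: "L \<in> sets borel" using Hb \<theta>(2) by (auto simp: L_def)
  have bound: "hausdorff_content t L \<le> ennreal (C * \<rho> ^ n / (1 - \<rho>))" for n
  proof -
    have "hausdorff_content t L \<le> hausdorff_content t (H n)"
      by (intro hausdorff_content_mono) (auto simp: L_def)
    also have "\<dots> \<le> (\<Sum>k. hausdorff_content t (G (k + n)))"
      unfolding H_def by (rule hausdorff_content_UN_le)
    also have "\<dots> \<le> (\<Sum>k. ennreal (C * \<rho> ^ (k + n)))"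
      by (rule suminf_le) (use content in auto)
    also have "\<dots> = ennreal (C * \<rho> ^ n / (1 - \<rho>))"
    proof (rule suminf_ennreal_eq)
      have "(\<lambda>k. C * \<rho> ^ n * \<rho> ^ k) sums (C * \<rho> ^ n * (1 / (1 - \<rho>)))"
        using \<rho> by (intro sums_mult geometric_sums) auto
      then show "(\<lambda>k. C * \<rho> ^ (k + n)) sums (C * \<rho> ^ n / (1 - \<rho>))"
        by (simp add: power_add mult_ac)
    qed (use C \<rho> in auto)
    finally show ?thesis .
  qed
  have "(\<lambda>n. ennreal (C * \<rho> ^ n / (1 - \<rho>))) \<longlonglongrightarrow> ennreal (C * 0 / (1 - \<rho>))"
    using \<rho> by (intro tendsto_ennrealI tendsto_intros LIMSEQ_realpow_zero) auto
  then have "hausdorff_content t L \<le> ennreal (C * 0 / (1 - \<rho>))"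
    using bound by (intro LIMSEQ_le_const) auto
  then have "hausdorff_content t L = 0" by simp
  then have "hausdorff_dim L \<le> t" using t by (intro hausdorff_dim_le)
  then show ?thesis using measure_dim_le[OF Lb pos] by simp
qed

lemma prob_space_convolution:
  fixes \<mu> \<nu> :: "real measure"
  assumes "prob_space \<mu>" "prob_space \<nu>" "sets \<mu> = sets borel" "sets \<nu> = sets borel"
  shows "prob_space (\<mu> \<star> \<nu>)"
proof -
  interpret pair_prob_space \<mu> \<nu> using assms(1,2)
    by (simp add: pair_prob_space_def pair_sigma_finite_def prob_space_imp_sigma_finite)
  have [measurable_cong]: "sets \<mu> = sets borel" "sets \<nu> = sets borel" by fact+
  show ?thesis unfolding convolution_def by (rule P.prob_space_distr) measurable
qed

lemma measure_convolution_ge: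
  fixes \<mu> \<nu> :: "real measure"
  assumes "prob_space \<mu>" "prob_space \<nu>" and s: "sets \<mu> = sets borel" "sets \<nu> = sets borel"
    and Y: "Y \<in> sets borel" and S: "S \<in> sets borel" "emeasure \<nu> S = 1" and G: "G \<in> sets borel"
    and sub: "\<And>y x. y \<in> Y \<Longrightarrow> x \<in> S \<Longrightarrow> y + x \<in> G"
  shows "measure (\<mu> \<star> \<nu>) G \<ge> measure \<mu> Y"
proof -
  interpret pair_prob_space \<mu> \<nu> using assms(1,2)
    by (simp add: pair_prob_space_def pair_sigma_finite_def prob_space_imp_sigma_finite)
  have [measurable_cong]: "sets \<mu> = sets borel" "sets \<nu> = sets borel" by fact+
  interpret C: prob_space "\<mu> \<star> \<nu>" using assms by (intro prob_space_convolution)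
  have m: "(\<lambda>(x, y). x + y) \<in> borel_measurable (\<mu> \<Otimes>\<^sub>M \<nu>)" by measurable
  have "emeasure \<mu> Y = emeasure \<mu> Y * emeasure \<nu> S" using S by simp
  also have "\<dots> = emeasure (\<mu> \<Otimes>\<^sub>M \<nu>) (Y \<times> S)"
    using Y S s by (intro M2.emeasure_pair_measure_Times[symmetric]) auto
  also have "\<dots> \<le> emeasure (\<mu> \<Otimes>\<^sub>M \<nu>) ((\<lambda>(x, y). x + y) -` G \<inter> space (\<mu> \<Otimes>\<^sub>M \<nu>))"
    using sub measurable_sets[OF m G] sets_eq_imp_space_eq[OF s(1)] sets_eq_imp_space_eq[OF s(2)]
    by (intro emeasure_mono) (auto simp: space_pair_measure)
  also have "\<dots> = emeasure (\<mu> \<star> \<nu>) G"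
    unfolding convolution_def using m G by (simp add: emeasure_distr)
  finally show ?thesis by (simp add: M1.emeasure_eq_measure C.emeasure_eq_measure)
qed

text \<open>At scales inside a window of frozen digits only the first summand moves, and by invariance
  it is captured there by few truncations with probability bounded below.\<close>

lemma (in pisot_invariant_measure) convolution_dim_less_1:
  assumes dim: "measure_dim \<nu> < 1" and M0: "M0 > 0"
    and dm: "digit_measure (\<beta> ^ M0) Dg"
    and Dg: "\<And>j. Dg j \<subseteq> beta_sums \<beta> M0 \<lceil>\<beta>\<rceil>"
    and frozen: "\<And>j. j \<in> windows n \<Longrightarrow> Dg j = {0}"
  shows "measure_dim (\<nu> \<star> digit_measure.digit_distr (\<beta> ^ M0) Dg) < 1"
proof -
  interpret D: digit_measure "\<beta> ^ M0" Dg by fact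
  define B where "B = \<beta> ^ M0"
  define \<tau> where "\<tau> = D.digit_distr"
  have \<tau>: "prob_space \<tau>" "sets \<tau> = sets borel"
    unfolding \<tau>_def by (fact D.prob_space_digit_distr D.sets_digit_distr)+
  have b0: "\<beta> > 0" using \<beta>_gt_1 by simp
  obtain M s p where M: "M \<ge> 1" and s: "0 < s" "s < 1" and p: "p > 0"
    and few: "\<And>j. j \<ge> 1 \<Longrightarrow> \<exists>E. E \<in> sets borel \<and> E \<subseteq> {0..<1} \<and> prob E \<ge> p \<and>
      finite (beta_trunc \<beta> (j * M) ` E) \<and> real (card (beta_trunc \<beta> (j * M) ` E)) \<le> \<beta> powr (s * real (j * M))"
    using few_truncations[OF dim] by metis
  obtain c C where C: "C \<ge> 1"
    and count: "\<And>N S. S \<subseteq> beta_sums \<beta> N (\<lceil>\<beta>\<rceil> + \<lceil>\<beta>\<rceil>) \<Longrightarrow> S \<subseteq> {0..3} \<Longrightarrow> finite S \<and> real (card S) \<le> C * \<beta> ^ N"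
    using pisot_beta_sums_count[OF pisot, of "\<lceil>\<beta>\<rceil> + \<lceil>\<beta>\<rceil>" 3] by metis
  have ceil: "0 \<le> \<lceil>\<beta>\<rceil>" using b0 by linarith
  \<comment> \<open>Solves t - s - (1 - t) n = (1 - s)/2. With x = 2^k M0, the covering below has
    cost exponent about (1 - t) n x - (t - s) x, which then equals -(1 - s) x/2.\<close>
  define t where "t = 1 - (1 - s) / (2 * (real n + 1))"
  have t1: "1 - t = (1 - s) / (2 * (real n + 1))" by (simp add: t_def)
  have t: "0 < t" "t < 1" "t - s - (1 - t) * n = (1 - s) / 2"
  proof -
    have "1 - t > 0" unfolding t1 using s by simp
    then show "t < 1" by simp
    have e: "(1 - t) * (real n + 1) = (1 - s) / 2" unfolding t1 by (simp add: field_simps)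
    then show "t - s - (1 - t) * n = (1 - s) / 2" by (simp add: algebra_simps)
    have "(1 - t) * (real n + 1) \<ge> (1 - t) * 1" using \<open>1 - t > 0\<close> by (intro mult_left_mono) auto
    then show "0 < t" using e s by simp
  qed
  \<comment> \<open>Start of the k-th window, counted in base \<beta> digits; \<open>R k\<close> is
    its length 2^k M0 rounded down to a multiple of the block length \<open>M\<close>.\<close>
  define q where "q = (\<lambda>k. 2 ^ k * n * M0)"
  define R where "R = (\<lambda>k. 2 ^ k * M0 div M * M)"
  have R_le: "R k \<le> 2 ^ k * M0" for k by (simp add: R_def)
  have R_ge: "2 ^ k * M0 < R k + M" for k
    using M div_mult_mod_eq[of "2 ^ k * M0" M] mod_less_divisor[of M "2 ^ k * M0"] unfolding R_def by linarith
  \<comment> \<open>All possible sums of the two truncations at the window start: the first summand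
    lies in [0,1], the second, from \<open>F k\<close>, in [0,2].\<close>
  define Z where "Z = (\<lambda>k. beta_sums \<beta> (q k) (\<lceil>\<beta>\<rceil> + \<lceil>\<beta>\<rceil>) \<inter> {0..3})"
  define F where "F = (\<lambda>k. beta_sums \<beta> (q k) \<lceil>\<beta>\<rceil> \<inter> {0..2})"
  have Z: "finite (Z k)" "real (card (Z k)) \<le> C * \<beta> ^ q k" for k
    using count[of "Z k" "q k"] by (auto simp: Z_def)
  have FZ: "F k \<subseteq> Z k" for k
    using beta_sums_plus[OF _ beta_sums_0[OF ceil]] by (force simp: F_def Z_def)
  have key: "\<exists>G. G \<in> sets borel \<and> measure (\<nu> \<star> \<tau>) G \<ge> p \<and>
     hausdorff_content t G \<le> ennreal ((C * 3 * \<beta> ^ M) * (\<beta> powr (- (1 - s) / 2)) ^ k)"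
    if k: "2 ^ k \<ge> M" for k
  proof -
    have "2 ^ k * M0 div M \<ge> 1" using k M M0
      by (metis div_le_mono div_self le_square mult_le_mono mult_1_right not_one_le_zero One_nat_def Suc_leI)
    from few[OF this] obtain E where E: "E \<in> sets borel" "E \<subseteq> {0..<1}" "prob E \<ge> p"
      and V: "finite (beta_trunc \<beta> (R k) ` E)" "real (card (beta_trunc \<beta> (R k) ` E)) \<le> \<beta> powr (s * real (R k))"
      unfolding R_def by blast
    define V where "V = beta_trunc \<beta> (R k) ` E"
    \<comment> \<open>One unit for the remainder of the invariant point and two for the tail of the
      digit expansion.\<close>
    define \<delta> where "\<delta> = 3 / \<beta> ^ (q k + R k)"
    have \<delta>: "\<delta> > 0" using b0 by (simp add: \<delta>_def)
    define G where "G = (\<Union>z\<in>Z k. \<Union>v\<in>V. {z + v / \<beta> ^ q k .. z + v / \<beta> ^ q k + \<delta>})"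
    have Gb: "G \<in> sets borel" unfolding G_def using Z V by (intro sets.finite_UN) (auto simp: V_def)
    define Nk where "Nk = 2 ^ k * n"
    define \<eta> where "\<eta> = 2 / \<beta> ^ (M0 * (2 ^ k * Suc n))"
    define S where "S = (\<Union>f\<in>F k. {f .. f + \<eta>})"
    have Sb: "S \<in> sets borel" unfolding S_def using finite_subset[OF FZ Z(1)] by (intro sets.finite_UN) auto
    have S1: "emeasure \<tau> S = 1"
      unfolding \<tau>_def
    proof (rule D.digit_distr_full[OF Sb])
      fix w assume w: "w \<in> space D.digit_space"
      define f where "f = (\<lambda>m. \<Sum>j<m. w j / (\<beta> ^ M0) ^ j)"
      \<comment> \<open>Digits inside the window are 0, so the partial sum does not move until the
        window ends.\<close>
      have fz: "f (2 ^ k * Suc n) = f Nk"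
      proof -
        have "w j = 0" if "j \<in> {..<2 ^ k * Suc n} - {..<Nk}" for j
        proof -
          have "j \<in> windows n" using that by (auto simp: windows_def Nk_def)
          then show ?thesis using w frozen[of j] by (auto simp: D.space_digit_space)
        qed
        then show ?thesis unfolding f_def by (intro sum.mono_neutral_right) (auto simp: Nk_def)
      qed
      have fsum: "f m \<in> beta_sums \<beta> (m * M0) \<lceil>\<beta>\<rceil>" for m
      proof (induction m)
        case 0
        then show ?case using ceil by (simp add: f_def beta_sums_0)
      next
        case (Suc m)
        have "w m \<in> beta_sums \<beta> M0 \<lceil>\<beta>\<rceil>" using w Dg by (auto simp: D.space_digit_space)
        then have "f m + w m / \<beta> ^ (m * M0) \<in> beta_sums \<beta> (m * M0 + M0) \<lceil>\<beta>\<rceil>"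
          using Suc b0 by (intro beta_sums_concat) auto
        then show ?case by (simp add: f_def power_mult[symmetric] mult.commute add.commute)
      qed
      obtain r where r: "0 \<le> r" "r \<le> 2 / (\<beta> ^ M0) ^ (2 ^ k * Suc n)" "D.expansion w = f (2 ^ k * Suc n) + r"
        using D.expansion_split[OF w, of "2 ^ k * Suc n"] unfolding f_def by blast
      \<comment> \<open>Splitting at 0 bounds the whole expansion by 2, which places the partial sum
        in \<open>F k\<close>.\<close>
      obtain r' where r': "r' \<le> 2" "D.expansion w = r'"
        using D.expansion_split[OF w, of 0] by auto
      have f0: "f Nk \<ge> 0" unfolding f_def using D.digit_01[OF w] b0 by (intro sum_nonneg) auto
      have "f Nk \<in> F k" using fsum[of Nk] f0 r r' fz by (simp add: F_def q_def Nk_def)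
      moreover have "D.expansion w \<in> {f Nk .. f Nk + \<eta>}"
        using r fz by (simp add: \<eta>_def power_mult)
      ultimately show "D.expansion w \<in> S" unfolding S_def by blast
    qed
    \<comment> \<open>Points whose digits inside the window are those of a point of
      \<open>E\<close>; invariance gives them the same probability as \<open>E\<close>.\<close>
    define Y where "Y = T (q k) -` E \<inter> {0..<1}"
    have TE: "T (q k) -` E \<in> sets borel"
      using measurable_sets[OF funpow_beta_map_measurable E(1), of "q k" \<beta>] by simp
    then have Yb: "Y \<in> sets borel" by (simp add: Y_def)
    have "prob Y = prob (T (q k) -` E)"
      using AE_unit TE by (intro finite_measure_eq_AE) (auto simp: Y_def)
    then have Yp: "prob Y \<ge> p" using prob_T_vimage[OF E(1)] E(3) by simp
    have sub: "y + x \<in> G" if y: "y \<in> Y" and x: "x \<in> S" for y x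
    proof -
      obtain f where f: "f \<in> F k" "f \<le> x" "x \<le> f + \<eta>" using x by (auto simp: S_def)
      have y01: "0 \<le> y" "y < 1" and TyE: "T (q k) y \<in> E" using y by (auto simp: Y_def)
      define v where "v = beta_trunc \<beta> (R k) (T (q k) y)"
      have vV: "v \<in> V" using TyE by (auto simp: v_def V_def)
      define e where "e = T (R k) (T (q k) y)"
      have e: "0 \<le> e" "e < 1"
        using funpow_beta_map_range[of "T (q k) y"] TyE E(2) by (auto simp: e_def)
      define l where "l = beta_trunc \<beta> (q k) y"
      have l: "l \<in> beta_sums \<beta> (q k) \<lceil>\<beta>\<rceil>" "0 \<le> l" "l \<le> 1"
        using beta_trunc_in_beta_sums[OF \<beta>_gt_1 y01, of "q k"] beta_trunc_bounds(1)[OF \<beta>_gt_1 y01, of "q k"] y01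
        by (auto simp: l_def)
      have zZ: "f + l \<in> Z k" using f(1) l beta_sums_plus[of f \<beta> "q k" "\<lceil>\<beta>\<rceil>" l "\<lceil>\<beta>\<rceil>"] by (auto simp: F_def Z_def)
      have "T (q k) y = v + e / \<beta> ^ R k" by (simp add: v_def e_def beta_trunc_def)
      then have "y = l + (v + e / \<beta> ^ R k) / \<beta> ^ q k" by (simp add: l_def beta_trunc_def)
      then have yeq: "y = l + v / \<beta> ^ q k + e / \<beta> ^ (q k + R k)"
        by (simp add: add_divide_distrib power_add mult.commute)
      have e': "0 \<le> e / \<beta> ^ (q k + R k)" "e / \<beta> ^ (q k + R k) \<le> 1 / \<beta> ^ (q k + R k)"
        using e b0 by (auto intro!: divide_right_mono)
      have "\<eta> \<le> 2 / \<beta> ^ (q k + R k)"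
      proof -
        have "q k + R k \<le> M0 * (2 ^ k * Suc n)" using R_le[of k] by (simp add: q_def algebra_simps)
        then show ?thesis unfolding \<eta>_def using \<beta>_gt_1 by (intro divide_left_mono power_increasing) auto
      qed
      moreover have "\<delta> = 2 / \<beta> ^ (q k + R k) + 1 / \<beta> ^ (q k + R k)" by (simp add: \<delta>_def add_divide_distrib[symmetric])
      ultimately have "y + x \<in> {(f + l) + v / \<beta> ^ q k .. (f + l) + v / \<beta> ^ q k + \<delta>}"
        using e' f(2,3) yeq unfolding atLeastAtMost_iff by (intro conjI; linarith)
      then show ?thesis unfolding G_def using zZ vV by blast
    qed
    have Gp: "measure (\<nu> \<star> \<tau>) G \<ge> p"
      using measure_convolution_ge[OF prob_space_axioms \<tau>(1) sets_eq \<tau>(2) Yb Sb S1 Gb sub] Yp by simp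
    have "hausdorff_content t G \<le> of_nat (card (Z k)) * (of_nat (card V) * ennreal (\<delta> powr t))"
      unfolding G_def
    proof (intro hausdorff_content_finite_UN_le Z(1))
      fix z v
      have "diameter {z + v / \<beta> ^ q k .. z + v / \<beta> ^ q k + \<delta>} = \<delta>"
        using \<delta> by (subst diameter_closed_interval) auto
      then show "hausdorff_content t {z + v / \<beta> ^ q k .. z + v / \<beta> ^ q k + \<delta>} \<le> ennreal (\<delta> powr t)"
        using hausdorff_content_le_diameter[of "{z + v / \<beta> ^ q k .. z + v / \<beta> ^ q k + \<delta>}" t] by simp
    qed (use V in \<open>simp add: V_def\<close>)
    also have "\<dots> = ennreal (real (card (Z k)) * (real (card V) * \<delta> powr t))"
      by (simp add: ennreal_mult ennreal_of_nat_eq_real_of_nat)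
    also have "\<dots> \<le> ennreal ((C * 3 * \<beta> ^ M) * (\<beta> powr (- (1 - s) / 2)) ^ k)"
    proof (rule ennreal_leI)
      have \<delta>_powr: "\<delta> powr t = 3 powr t * \<beta> powr (- t * real (q k + R k))"
      proof -
        have "\<delta> = 3 * \<beta> powr (- real (q k + R k))"
          using b0 by (simp only: \<delta>_def powr_minus_divide powr_realpow times_divide_eq_right mult_1_right)
        then have "\<delta> powr t = 3 powr t * \<beta> powr (- real (q k + R k) * t)"
          using b0 by (simp only: powr_mult powr_powr)
        then show ?thesis by (simp only: mult_minus_left mult_minus_right mult.commute)
      qed
      have "real (card (Z k)) * (real (card V) * \<delta> powr t) \<le> (C * \<beta> ^ q k) * (\<beta> powr (s * real (R k)) * \<delta> powr t)"
        using Z(2)[of k] V(2) C b0 by (intro mult_mono) (auto simp: V_def)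
      also have "(C * \<beta> ^ q k) * (\<beta> powr (s * real (R k)) * \<delta> powr t)
        = C * 3 powr t * \<beta> powr (real (q k) + s * real (R k) + - t * real (q k + R k))"
      proof -
        have "\<beta> powr (real (q k) + s * real (R k) + - t * real (q k + R k))
          = \<beta> ^ q k * (\<beta> powr (s * real (R k)) * \<beta> powr (- t * real (q k + R k)))"
          using b0 by (simp only: powr_add powr_realpow mult.assoc)
        then show ?thesis by (simp only: \<delta>_powr mult_ac)
      qed
      also have "\<dots> \<le> C * 3 * \<beta> powr (real M + (- (1 - s) / 2) * real k)"
      proof (intro mult_mono powr_mono)
        show "3 powr t \<le> (3::real)" using powr_mono[of t 1 3] t by simp
        define x where "x = real (2 ^ k * M0)"
        have R1: "x - real M \<le> real (R k)" using R_ge[of k] unfolding x_def by linarith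
        have qx: "real (q k) = real n * x" by (simp add: q_def x_def)
        have kx: "real k \<le> x"
        proof -
          have "k * 1 \<le> 2 ^ k * M0" using M0 by (intro mult_mono less_imp_le_nat[OF less_exp]) auto
          then show ?thesis unfolding x_def by (simp only: of_nat_le_iff mult_1_right)
        qed
        have ts: "0 \<le> t - s" "t - s \<le> 1"
        proof -
          have "(1 - t) * n \<ge> 0" using t by simp
          moreover have "(1 - s) / 2 \<ge> 0" using s by simp
          moreover have "t - s = (1 - t) * n + (1 - s) / 2" unfolding t(3)[symmetric] by simp
          ultimately show "0 \<le> t - s" by simp
          show "t - s \<le> 1" using t s by simp
        qed
        have "real (q k) + s * real (R k) + - t * real (q k + R k) = (1 - t) * n * x - (t - s) * real (R k)"
          by (simp add: qx algebra_simps)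
        also have "\<dots> \<le> (1 - t) * n * x - (t - s) * (x - real M)"
          using R1 ts by (intro diff_left_mono mult_left_mono)
        also have "\<dots> = (t - s) * real M - (t - s - (1 - t) * n) * x" by (simp add: algebra_simps)
        also have "\<dots> \<le> 1 * real M - (1 - s) / 2 * real k"
          unfolding t(3) using ts kx s by (intro diff_mono mult_right_mono mult_left_mono) auto
        also have "\<dots> = real M + (- (1 - s) / 2) * real k" by (simp add: field_simps)
        finally show "real (q k) + s * real (R k) + - t * real (q k + R k) \<le> real M + (- (1 - s) / 2) * real k" .
      qed (use \<beta>_gt_1 C in auto)
      also have "\<beta> powr (real M + (- (1 - s) / 2) * real k) = \<beta> ^ M * (\<beta> powr (- (1 - s) / 2)) ^ k"
        using b0 by (simp add: powr_add powr_realpow powr_power mult.commute)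
      finally show "real (card (Z k)) * (real (card V) * \<delta> powr t) \<le> (C * 3 * \<beta> ^ M) * (\<beta> powr (- (1 - s) / 2)) ^ k"
        by (simp add: mult.assoc)
    qed
    finally show ?thesis using Gb Gp by blast
  qed
  \<comment> \<open>Shifting the index by \<open>M\<close> makes every window at least one block
    long.\<close>
  have "M \<le> 2 ^ (k + M)" for k
    using less_exp[of "k + M"] by linarith
  then have "\<forall>k. \<exists>G. G \<in> sets borel \<and> measure (\<nu> \<star> \<tau>) G \<ge> p \<and>
     hausdorff_content t G \<le> ennreal ((C * 3 * \<beta> ^ M) * (\<beta> powr (- (1 - s) / 2)) ^ (k + M))"
    using key by simp
  then obtain G where G: "\<And>k. G k \<in> sets borel" "\<And>k. measure (\<nu> \<star> \<tau>) (G k) \<ge> p"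
    "\<And>k. hausdorff_content t (G k) \<le> ennreal ((C * 3 * \<beta> ^ M) * (\<beta> powr (- (1 - s) / 2)) ^ (k + M))"
    by metis
  define \<rho> where "\<rho> = \<beta> powr (- (1 - s) / 2)"
  have \<rho>: "0 \<le> \<rho>" "\<rho> < 1" unfolding \<rho>_def using \<beta>_gt_1 s by (auto simp: powr_less_one)
  have "measure_dim (\<nu> \<star> \<tau>) \<le> t"
  proof (rule measure_dim_le_limsup[where C = "C * 3 * \<beta> ^ M * \<rho> ^ M" and \<rho> = \<rho> and G = G and p = p])
    show "prob_space (\<nu> \<star> \<tau>)" using prob_space_axioms \<tau> by (intro prob_space_convolution) auto
    show "hausdorff_content t (G k) \<le> ennreal (C * 3 * \<beta> ^ M * \<rho> ^ M * \<rho> ^ k)" for k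
      using G(3)[of k] by (simp add: \<rho>_def power_add mult_ac)
  qed (use G p t \<rho> C b0 in auto)
  then show ?thesis using t by (simp add: \<tau>_def)
qed

section \<open>Construction of the measures and resonance\<close>

text \<open>Outside the windows the digits are truncations of the points 4i/B: truncation moves each
  down by less than 1/B, leaving gaps of at least 3/B. Having at least B^(1 - 1/n) digits on all but
  a proportion 2/n of the positions gives the stated dimension.\<close>

lemma sparse_measure:
  assumes pisot: "pisot \<beta>" and n: "n \<ge> 3"
  shows "\<exists>\<tau> :: real measure. prob_space \<tau> \<and> sets \<tau> = sets borel \<and>
    (1 - 1 / real n) * (1 - 2 / real n) \<le> measure_dim \<tau> \<and> measure_dim \<tau> \<le> 1 \<and>
    (\<forall>\<nu>. pisot_invariant_measure \<nu> \<beta> \<and> measure_dim \<nu> < 1 \<longrightarrow> measure_dim (\<nu> \<star> \<tau>) < 1)"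
proof -
  have b1: "\<beta> > 1" using pisot by (simp add: pisot_def)
  \<comment> \<open>Makes B^(1/n) at least 8, so even B/8 digits amount to B^(1 - 1/n).\<close>
  obtain M where M: "\<beta> ^ M > 8 ^ n" using real_arch_pow[OF b1] by blast
  define B where "B = \<beta> ^ M"
  have "(1::real) \<le> 8 ^ n" by (rule one_le_power) simp
  with M have "\<beta> ^ M > 1" by linarith
  then have M0: "M > 0" by (cases M) auto
  have "(8::real) ^ 1 \<le> 8 ^ n" using n by (intro power_increasing) auto
  then have B: "B > 8" using M by (simp add: B_def)
  define m where "m = nat \<lfloor>B / 4\<rfloor>"
  have m: "real m \<le> B / 4" "real m \<ge> B / 8"
  proof -
    show "real m \<le> B / 4" unfolding m_def using B by (intro of_nat_floor) simp
    show "real m \<ge> B / 8" unfolding m_def using B by linarith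
  qed
  have m_ge: "real m \<ge> B powr (1 - 1 / n)"
  proof -
    have "(8::real) = (8 ^ n) powr (1 / n)" using n by (simp add: powr_powr flip: powr_realpow)
    also have "\<dots> \<le> B powr (1 / n)" using M by (intro powr_mono2) (auto simp: B_def)
    finally have "B / B powr (1 / n) \<le> B / 8" using B by (intro divide_left_mono) auto
    moreover have "B powr (1 - 1 / n) = B / B powr (1 / n)" using B by (simp add: powr_diff)
    ultimately show ?thesis using m(2) by linarith
  qed
  define L where "L = beta_trunc \<beta> M"
  define x where "x = (\<lambda>i::nat. 4 * real i / B)"
  have x01: "0 \<le> x i" "x i < 1" if "i < m" for i
    using that m(1) B by (auto simp: x_def field_simps)
  have sep: "\<bar>L (x i) - L (x j)\<bar> \<ge> 3 / B" if ij: "i < m" "j < m" "i \<noteq> j" for i j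
  proof -
    have "\<bar>real i - real j\<bar> \<ge> 1" using ij by linarith
    then have "4 / B * \<bar>real i - real j\<bar> \<ge> 4 / B * 1" using B by (intro mult_left_mono) auto
    moreover have "x i - x j = 4 / B * (real i - real j)"
      by (simp add: x_def right_diff_distrib)
    then have "\<bar>x i - x j\<bar> = 4 / B * \<bar>real i - real j\<bar>" using B by (simp only: abs_mult) simp
    ultimately have "\<bar>x i - x j\<bar> \<ge> 4 / B" by simp
    moreover have "L (x i) \<le> x i" "x i - 1 / B < L (x i)" "L (x j) \<le> x j" "x j - 1 / B < L (x j)"
      using beta_trunc_bounds[OF b1 x01[OF ij(1)]] beta_trunc_bounds[OF b1 x01[OF ij(2)]]
      by (auto simp: L_def B_def)
    moreover have "4 / B = 3 / B + 1 / B" by (simp add: add_divide_distrib[symmetric])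
    ultimately show ?thesis by linarith
  qed
  define D where "D = (\<lambda>i. L (x i)) ` {..<m}"
  have inj: "inj_on (\<lambda>i. L (x i)) {..<m}"
  proof (rule inj_onI, rule ccontr)
    fix i j assume "i \<in> {..<m}" "j \<in> {..<m}" "L (x i) = L (x j)" "i \<noteq> j"
    then have "3 / B \<le> 0" using sep[of i j] by simp
    then show False using B by (simp add: divide_le_0_iff)
  qed
  have Dcard: "card D = m" unfolding D_def using inj by (simp add: card_image)
  have "m \<noteq> 0" using m(2) B by (intro notI) simp
  define Dg where "Dg = (\<lambda>j. if j \<in> windows n then {0} else D)"
  have Dsub: "v \<in> beta_sums \<beta> M \<lceil>\<beta>\<rceil> \<and> 0 \<le> v \<and> v < 1" if "v \<in> D" for v
    using that beta_trunc_in_beta_sums[OF b1 x01] beta_trunc_bounds(1)[OF b1 x01] x01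
    unfolding D_def L_def by (force intro: order_le_less_trans)
  interpret dm: digit_measure "\<beta> ^ M" Dg
  proof
    show "2 \<le> \<beta> ^ M" using B by (simp add: B_def)
    fix j
    show "finite (Dg j)" "Dg j \<noteq> {}" using \<open>m \<noteq> 0\<close> by (auto simp: Dg_def D_def lessThan_empty_iff)
    show "Dg j \<subseteq> {0..<1}" using Dsub by (auto simp: Dg_def)
    fix v w assume "v \<in> Dg j" "w \<in> Dg j" "v \<noteq> w"
    then show "3 / \<beta> ^ M \<le> \<bar>v - w\<bar>"
      using sep by (auto simp: Dg_def D_def B_def split: if_splits)
  qed
  define t where "t = (1 - 1 / real n) * (1 - 2 / real n)"
  have nn: "1 / real n < 1" "2 / real n < 1" using n by auto
  have t: "t > 0" using nn by (simp add: t_def)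
  have many: "(\<Prod>j<J. real (card (Dg j))) \<ge> (\<beta> ^ M) powr (t * real J)" for J
  proof -
    \<comment> \<open>Frozen positions carry a single digit and contribute the factor 1 to the
      product.\<close>
    define W where "W = {..<J} \<inter> windows n"
    have "(\<Prod>j<J. real (card (Dg j))) = (\<Prod>j\<in>{..<J} - W. real (card (Dg j)))"
      by (rule prod.mono_neutral_right) (auto simp: W_def Dg_def)
    also have "\<dots> = (\<Prod>j\<in>{..<J} - W. real m)"
      by (rule prod.cong) (auto simp: W_def Dg_def Dcard)
    also have "\<dots> = real m ^ (J - card W)" by (simp add: card_Diff_subset W_def)
    finally have eq: "(\<Prod>j<J. real (card (Dg j))) = real m ^ (J - card W)" .
    have cW: "card W \<le> J" using card_mono[of "{..<J}" W] by (auto simp: W_def)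
    have "real n * real (card W) \<le> 2 * real J"
      using card_windows_le[of n J] unfolding W_def of_nat_mult[symmetric]
      by (metis of_nat_le_iff of_nat_mult of_nat_numeral)
    then have "real (card W) \<le> 2 / n * real J" using n by (simp add: field_simps)
    then have "(1 - 2 / n) * real J \<le> real (J - card W)" using cW by (simp add: of_nat_diff left_diff_distrib)
    then have "(1 - 1 / n) * ((1 - 2 / n) * real J) \<le> (1 - 1 / n) * real (J - card W)"
      using nn by (intro mult_left_mono) auto
    then have "B powr (t * real J) \<le> B powr ((1 - 1 / n) * real (J - card W))"
      using B by (intro powr_mono) (auto simp: t_def mult.assoc)
    also have "\<dots> = (B powr (1 - 1 / n)) ^ (J - card W)" using B by (simp add: powr_power mult.commute)
    also have "\<dots> \<le> real m ^ (J - card W)" using m_ge by (intro power_mono) auto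
    finally show ?thesis by (simp add: eq B_def)
  qed
  show ?thesis
  proof (intro exI[of _ dm.digit_distr] conjI allI impI)
    show "prob_space dm.digit_distr" "sets dm.digit_distr = sets borel"
      by (fact dm.prob_space_digit_distr dm.sets_digit_distr)+
    then show "measure_dim dm.digit_distr \<le> 1" by (rule measure_dim_le_1)
    show "(1 - 1 / real n) * (1 - 2 / real n) \<le> measure_dim dm.digit_distr"
      using dm.measure_dim_digit_distr_ge[OF t many] by (simp add: t_def)
    fix \<nu> assume \<nu>: "pisot_invariant_measure \<nu> \<beta> \<and> measure_dim \<nu> < 1"
    then interpret pisot_invariant_measure \<nu> \<beta> by simp
    have "0 \<le> \<lceil>\<beta>\<rceil>" using b1 by linarith
    then have "Dg j \<subseteq> beta_sums \<beta> M \<lceil>\<beta>\<rceil>" for j using Dsub beta_sums_0 by (auto simp: Dg_def)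
    then show "measure_dim (\<nu> \<star> dm.digit_distr) < 1"
      using M0 \<nu> dm.digit_measure_axioms by (intro convolution_dim_less_1[where n = n]) (auto simp: Dg_def)
  qed
qed

theorem theorem5p5:
  fixes \<beta> :: real
  assumes "pisot \<beta>"
  shows "\<exists>\<tau> :: nat \<Rightarrow> real measure.
     (\<forall>n. prob_space (\<tau> n) \<and> sets (\<tau> n) = sets borel) \<and>
     (\<lambda>n. measure_dim (\<tau> n)) \<longlonglongrightarrow> 1 \<and>
     (\<forall>\<nu> :: real measure.
        prob_space \<nu> \<and> sets \<nu> = sets borel \<and> emeasure \<nu> {0..1} = 1 \<and>
        (\<forall>A \<in> sets borel. emeasure \<nu> (beta_map \<beta> -` A) = emeasure \<nu> A) \<and>
        0 < measure_dim \<nu> \<and> measure_dim \<nu> < 1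
        \<longrightarrow> (\<forall>\<^sub>F n in sequentially. resonate \<nu> (\<tau> n)))"
proof -
  \<comment> \<open>The shift by 3 keeps the window parameter in the range of the construction,
    where the lower bound is positive.\<close>
  define t where "t = (\<lambda>n. (1 - 1 / real (n + 3)) * (1 - 2 / real (n + 3)))"
  have "\<forall>n. \<exists>\<tau> :: real measure. prob_space \<tau> \<and> sets \<tau> = sets borel \<and>
    t n \<le> measure_dim \<tau> \<and> measure_dim \<tau> \<le> 1 \<and>
    (\<forall>\<nu>. pisot_invariant_measure \<nu> \<beta> \<and> measure_dim \<nu> < 1 \<longrightarrow> measure_dim (\<nu> \<star> \<tau>) < 1)"
    unfolding t_def by (intro allI sparse_measure assms) simp
  then obtain \<tau> :: "nat \<Rightarrow> real measure" where \<tau>: "\<And>n. prob_space (\<tau> n)" "\<And>n. sets (\<tau> n) = sets borel"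
    and dim: "\<And>n. t n \<le> measure_dim (\<tau> n)" "\<And>n. measure_dim (\<tau> n) \<le> 1"
    and conv: "\<And>n \<nu>. pisot_invariant_measure \<nu> \<beta> \<Longrightarrow> measure_dim \<nu> < 1 \<Longrightarrow> measure_dim (\<nu> \<star> \<tau> n) < 1"
    by metis
  have "(\<lambda>n. c / real (n + 3)) \<longlonglongrightarrow> 0" for c :: real
    by (rule LIMSEQ_ignore_initial_segment[OF lim_const_over_n])
  then have "t \<longlonglongrightarrow> (1 - 0) * (1 - 0)"
    unfolding t_def by (intro tendsto_mult tendsto_diff tendsto_const)
  then have "t \<longlonglongrightarrow> 1" by simp
  then have lim: "(\<lambda>n. measure_dim (\<tau> n)) \<longlonglongrightarrow> 1"
    using dim by (intro tendsto_sandwich[of t "\<lambda>n. measure_dim (\<tau> n)" sequentially "\<lambda>_. 1"]) auto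
  have res: "\<forall>\<^sub>F n in sequentially. resonate \<nu> (\<tau> n)"
    if \<nu>: "pisot_invariant_measure \<nu> \<beta>" and pos: "0 < measure_dim \<nu>" and less: "measure_dim \<nu> < 1" for \<nu>
  proof -
    \<comment> \<open>From here on the dimensions add up to more than 1, so resonance only asks that
      the convolution have dimension below 1.\<close>
    have "\<forall>\<^sub>F n in sequentially. 1 - measure_dim \<nu> < measure_dim (\<tau> n)"
      using order_tendstoD(1)[OF lim] pos by simp
    then show ?thesis
      by eventually_elim (use conv[OF \<nu> less] in \<open>simp add: resonate_def\<close>)
  qed
  show ?thesis
  proof (intro exI[of _ \<tau>] conjI allI impI)
    fix \<nu> :: "real measure"
    assume \<nu>: "prob_space \<nu> \<and> sets \<nu> = sets borel \<and> emeasure \<nu> {0..1} = 1 \<and>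
        (\<forall>A \<in> sets borel. emeasure \<nu> (beta_map \<beta> -` A) = emeasure \<nu> A) \<and>
        0 < measure_dim \<nu> \<and> measure_dim \<nu> < 1"
    then have "pisot_invariant_measure \<nu> \<beta>"
      unfolding pisot_invariant_measure_def pisot_invariant_measure_axioms_def using assms by blast
    then show "\<forall>\<^sub>F n in sequentially. resonate \<nu> (\<tau> n)" using res \<nu> by blast
  qed (use \<tau> lim in auto)
qed

end
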